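(* Let $\kappa_\Phi(x,y,z) = -x^2-y^2+z^2+xyz-2$ on $\mathbb{R}^3$ and let $\Gamma$ be the group of polynomial automorphisms of $\mathbb{R}^3$ described in the context. For every real $k$ with $-14\le k<2$, the action of $\Gamma$ on $\kappa_\Phi^{-1}(k)$ is ergodic.
   Context: $\Gamma$ is the group of polynomial automorphisms of $\mathbb{R}^3$ generated by the Vieta involutions $(x,y,z)\mapsto(yz-x,y,z)$, $(x,y,z)\mapsto(x,xz-y,z)$, $(x,y,z)\mapsto(x,y,-xy-z)$, the sign-changes $(x,y,z)\mapsto(x,-y,-z)$, $(-x,y,-z)$, $(-x,-y,z)$, and the transposition $(x,y,z)\mapsto(y,x,z)$. It preserves $\kappa_\Phi$. Up to sign, $\Gamma$ preserves the bivector field $(2z+xy)\,\partial_x\wedge\partial_y+(-2x+yz)\,\partial_y\wedge\partial_z+(-2y+zx)\,\partial_z\wedge\partial_x$, which is tangent to the level sets of $\kappa_\Phi$ and defines an area form, invariant up to sign, on the smooth part of each level set $\kappa_\Phi^{-1}(k)$ (the only critical point of $\kappa_\Phi$ is the origin, where $\kappa_\Phi=-2$). Ergodicity is with respect to the $\Gamma$-invariant measure on $\kappa_\Phi^{-1}(k)$ given by this area form (which lies in the smooth Lebesgue measure class): every $\Gamma$-invariant measurable subset is null or has null complement. *)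

theory Defs
  imports "HOL-Analysis.Analysis" "HOL-Algebra.Bij" "HOL-Algebra.Generated_Groups"
begin

definition kappa_Phi :: "real^3 \<Rightarrow> real" where
  "kappa_Phi p = - (p$1)\<^sup>2 - (p$2)\<^sup>2 + (p$3)\<^sup>2 + p$1 * p$2 * p$3 - 2"

definition level :: "real \<Rightarrow> (real^3) set" where
  "level k = kappa_Phi -` {k}"

definition smooth_part :: "real \<Rightarrow> (real^3) set" where
  "smooth_part k = {p \<in> level k. \<not> (kappa_Phi has_derivative (\<lambda>_. 0)) (at p)}"

lemma kappa_Phi_has_derivative:
  "(kappa_Phi has_derivative (\<lambda>h. (- 2 * p$1 + p$2 * p$3) * h$1
     + (- 2 * p$2 + p$3 * p$1) * h$2 + (2 * p$3 + p$1 * p$2) * h$3)) (at p)"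
proof -
  have *: "((\<lambda>v::real^3. v $ i) has_derivative (\<lambda>h. h $ i)) (at p)" for i
    by (rule bounded_linear_imp_has_derivative[OF bounded_linear_vec_nth])
  show ?thesis
    unfolding kappa_Phi_def[abs_def]
    by (auto intro!: derivative_eq_intros * simp: algebra_simps fun_eq_iff)
qed

lemma smooth_part_eq: "smooth_part k = level k - {0}"
proof -
  have "p = 0" if d: "(kappa_Phi has_derivative (\<lambda>_. 0)) (at p)" for p
  proof -
    have e: "(\<lambda>h::real^3. (- 2 * p$1 + p$2 * p$3) * h$1 + (- 2 * p$2 + p$3 * p$1) * h$2
        + (2 * p$3 + p$1 * p$2) * h$3) = (\<lambda>_. 0)"
      by (rule has_derivative_unique[OF kappa_Phi_has_derivative d])
    have x: "- 2 * p$1 + p$2 * p$3 = 0" and y: "- 2 * p$2 + p$3 * p$1 = 0"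
      and z: "2 * p$3 + p$1 * p$2 = 0"
      using fun_cong[OF e, of "axis 1 1"] fun_cong[OF e, of "axis 2 1"]
        fun_cong[OF e, of "axis 3 1"] by (simp_all add: axis_def)
    have z': "p$3 = - (p$1 * p$2) / 2" using z by simp
    have "p$1 * (4 + (p$2)\<^sup>2) = 0" "p$2 * (4 + (p$1)\<^sup>2) = 0"
      using x y unfolding z' by (simp_all add: field_simps power2_eq_square)
    moreover have "4 + (p$2)\<^sup>2 \<noteq> 0" "4 + (p$1)\<^sup>2 \<noteq> 0"
      using zero_le_power2[of "p$2"] zero_le_power2[of "p$1"] by linarith+
    ultimately show "p = 0" using z' by (simp add: vec_eq_iff forall_3)
  qed
  moreover have "(kappa_Phi has_derivative (\<lambda>_. 0)) (at 0)"
    using kappa_Phi_has_derivative[of 0] by simp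
  ultimately show ?thesis unfolding smooth_part_def by auto
qed


definition Gamma_generators :: "(real^3 \<Rightarrow> real^3) set" where
  "Gamma_generators =
    {\<lambda>p. vector [p$2 * p$3 - p$1, p$2, p$3],
     \<lambda>p. vector [p$1, p$1 * p$3 - p$2, p$3],
     \<lambda>p. vector [p$1, p$2, - p$1 * p$2 - p$3],
     \<lambda>p. vector [p$1, - p$2, - p$3],
     \<lambda>p. vector [- p$1, p$2, - p$3],
     \<lambda>p. vector [- p$1, - p$2, p$3],
     \<lambda>p. vector [p$2, p$1, p$3]}"

text \<open>Generating inside the group of all bijections gives the same group as generating
  inside the polynomial automorphisms.\<close>

definition Gamma_group :: "(real^3 \<Rightarrow> real^3) set" where
  "Gamma_group = generate (BijGroup UNIV) Gamma_generators"

lemma Gamma_generators_preserve_kappa: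
  "g \<in> Gamma_generators \<Longrightarrow> kappa_Phi (g p) = kappa_Phi p"
  unfolding Gamma_generators_def kappa_Phi_def
  by (auto simp: power2_eq_square algebra_simps)

lemma Gamma_generators_involutive:
  "g \<in> Gamma_generators \<Longrightarrow> g (g p) = p"
  unfolding Gamma_generators_def
  by (auto simp: vec_eq_iff forall_3 algebra_simps)

lemma Gamma_generators_subset_Bij: "Gamma_generators \<subseteq> carrier (BijGroup UNIV)"
proof
  fix g assume "g \<in> Gamma_generators"
  then have "bij g"
    by (intro o_bij[of g]) (auto simp: fun_eq_iff Gamma_generators_involutive)
  then show "g \<in> carrier (BijGroup UNIV)"
    by (simp add: BijGroup_def Bij_def)
qed


text \<open>Bivectors on \<open>\<real>\<^sup>3\<close> are represented as antisymmetric matrices.\<close>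

definition wedge :: "real^3 \<Rightarrow> real^3 \<Rightarrow> real^3^3" where
  "wedge u v = (\<chi> i j. u$i * v$j - u$j * v$i)"

definition bivector_field :: "real^3 \<Rightarrow> real^3^3" where
  "bivector_field p =
     (2 * p$3 + p$1 * p$2) *\<^sub>R wedge (axis 1 1) (axis 2 1)
   + (- 2 * p$1 + p$2 * p$3) *\<^sub>R wedge (axis 2 1) (axis 3 1)
   + (- 2 * p$2 + p$3 * p$1) *\<^sub>R wedge (axis 3 1) (axis 1 1)"

text \<open>The 2-form on the tangent plane that takes the value 1 on the bivector: since
  \<open>\<Lambda>\<^sup>2\<close> of the tangent plane is a line spanned by the bivector, \<open>u \<and> v\<close> is a unique
  multiple of it for tangent \<open>u\<close>, \<open>v\<close>. The value is meaningless for other arguments.\<close>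

definition area_form :: "real^3 \<Rightarrow> real^3 \<Rightarrow> real^3 \<Rightarrow> real" where
  "area_form p u v = (THE c. wedge u v = c *\<^sub>R bivector_field p)"

lemma area_form_eq:
  "wedge u v = c *\<^sub>R bivector_field p \<Longrightarrow> bivector_field p \<noteq> 0 \<Longrightarrow> area_form p u v = c"
  unfolding area_form_def by (rule the_equality) auto

definition chart_of_level ::
  "real \<Rightarrow> (real \<times> real) set \<Rightarrow> (real \<times> real \<Rightarrow> real^3) \<Rightarrow> (real \<times> real \<Rightarrow> real \<times> real \<Rightarrow> real^3) \<Rightarrow> bool"
  where
  "chart_of_level k U \<phi> D \<longleftrightarrow>
     open U \<and> inj_on \<phi> U \<and> \<phi> ` U \<subseteq> smooth_part k \<and>
     (\<forall>q\<in>U. (\<phi> has_derivative D q) (at q) \<and> inj (D q)) \<and>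
     (\<forall>h. continuous_on U (\<lambda>q. D q h))"

lemma chart_area_form:
  assumes c: "chart_of_level k U \<phi> D" and q: "q \<in> U"
  shows "wedge (D q (1, 0)) (D q (0, 1)) =
    area_form (\<phi> q) (D q (1, 0)) (D q (0, 1)) *\<^sub>R bivector_field (\<phi> q)"
proof -
  let ?p = "\<phi> q" let ?u = "D q (1, 0)" let ?v = "D q (0, 1)"
  define a b c where "a = - 2 * ?p$1 + ?p$2 * ?p$3" and "b = - 2 * ?p$2 + ?p$3 * ?p$1"
    and "c = 2 * ?p$3 + ?p$1 * ?p$2"
  have U: "open U" and D: "(\<phi> has_derivative D q) (at q)" and S: "\<phi> ` U \<subseteq> smooth_part k"
    using assms by (auto simp: chart_of_level_def)
  have "((\<lambda>q. kappa_Phi (\<phi> q)) has_derivative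
      (\<lambda>h. a * D q h $ 1 + b * D q h $ 2 + c * D q h $ 3)) (at q)"
    using has_derivative_compose[OF D kappa_Phi_has_derivative]
    unfolding a_def b_def c_def .
  moreover have "((\<lambda>q. kappa_Phi (\<phi> q)) has_derivative (\<lambda>_. 0)) (at q)"
    by (rule has_derivative_transform_within_open[OF has_derivative_const[of k] U q])
      (use S in \<open>auto simp: smooth_part_def level_def\<close>)
  ultimately have e: "(\<lambda>h. a * D q h $ 1 + b * D q h $ 2 + c * D q h $ 3) = (\<lambda>_. 0)"
    by (rule has_derivative_unique)
  have u: "a * ?u$1 + b * ?u$2 + c * ?u$3 = 0" and v: "a * ?v$1 + b * ?v$2 + c * ?v$3 = 0"
    using fun_cong[OF e] by auto
  define l m n where "l = ?u$2 * ?v$3 - ?u$3 * ?v$2" and "m = ?u$3 * ?v$1 - ?u$1 * ?v$3"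
    and "n = ?u$1 * ?v$2 - ?u$2 * ?v$1"
  have r: "a * m = b * l" "a * n = c * l" "b * n = c * m"
    using u v unfolding l_def m_def n_def by algebra+
  have W: "wedge ?u ?v = t *\<^sub>R bivector_field ?p \<longleftrightarrow> l = t * a \<and> m = t * b \<and> n = t * c" for t
    unfolding wedge_def bivector_field_def l_def m_def n_def a_def b_def c_def
    by (auto simp: vec_eq_iff forall_3 axis_def algebra_simps)
  have nz: "a \<noteq> 0 \<or> b \<noteq> 0 \<or> c \<noteq> 0"
  proof (rule ccontr)
    assume "\<not> ?thesis"
    then have "(kappa_Phi has_derivative (\<lambda>_. 0)) (at ?p)"
      using kappa_Phi_has_derivative[of ?p] unfolding a_def b_def c_def by simp
    then show False using S q by (auto simp: smooth_part_def)
  qed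
  have "\<exists>t. l = t * a \<and> m = t * b \<and> n = t * c"
  proof -
    consider "a \<noteq> 0" | "b \<noteq> 0" | "c \<noteq> 0" using nz by blast
    then show ?thesis
    proof cases
      case 1 then show ?thesis using r by (intro exI[of _ "l / a"]) (auto simp: field_simps)
    next
      case 2 then show ?thesis using r by (intro exI[of _ "m / b"]) (auto simp: field_simps)
    next
      case 3 then show ?thesis using r by (intro exI[of _ "n / c"]) (auto simp: field_simps)
    qed
  qed
  then obtain t where t: "wedge ?u ?v = t *\<^sub>R bivector_field ?p" using W by blast
  moreover have "bivector_field ?p \<noteq> 0"
  proof
    assume "bivector_field ?p = 0"
    then have "bivector_field ?p $ 1 $ 2 = 0" "bivector_field ?p $ 2 $ 3 = 0"
      "bivector_field ?p $ 3 $ 1 = 0" by simp_all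
    then show False using nz
      unfolding bivector_field_def wedge_def a_def b_def c_def by (simp add: axis_def)
  qed
  ultimately show ?thesis using area_form_eq by metis
qed

text \<open>The Borel measure of the area form: in every \<open>C\<^sup>1\<close> parametrization of an open piece of the
  smooth part it has density \<open>\<bar>\<phi>\<^sup>*\<omega>(\<partial>\<^sub>1,\<partial>\<^sub>2)\<bar>\<close>, and the singular points carry no mass.
  As countably many charts cover the smooth part, this determines the measure uniquely.\<close>

definition is_area_measure :: "real \<Rightarrow> (real^3) measure \<Rightarrow> bool" where
  "is_area_measure k M \<longleftrightarrow>
     sets M = sets (restrict_space borel (level k)) \<and>
     emeasure M (level k - smooth_part k) = 0 \<and>
     (\<forall>U \<phi> D A. chart_of_level k U \<phi> D \<longrightarrow> A \<in> sets M \<longrightarrow> A \<subseteq> \<phi> ` U \<longrightarrow>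
        emeasure M A =
          (\<integral>\<^sup>+q\<in>{q\<in>U. \<phi> q \<in> A}. ennreal \<bar>area_form (\<phi> q) (D q (1, 0)) (D q (0, 1))\<bar> \<partial>lborel))"


definition ergodic_action :: "('a \<Rightarrow> 'a) set \<Rightarrow> 'a measure \<Rightarrow> bool" where
  "ergodic_action G M \<longleftrightarrow>
     (\<forall>A\<in>sets M. (\<forall>g\<in>G. g ` A = A) \<longrightarrow> A \<in> null_sets M \<or> space M - A \<in> null_sets M)"

end

theory Submission
  imports Defs
begin

text \<open>Write \<open>c = k + 2\<close>, so that \<open>- 12 \<le> c < 4\<close> and the level surface is
  \<open>x\<^sup>2 + y\<^sup>2 - x * y * z = z\<^sup>2 - c\<close>. For \<open>\<bar>z\<bar> < 2\<close> the horizontal sections are ellipses, and the composition of the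
  first Vieta involution with the transposition rotates them, by an irrational angle for all but countably many
  heights. An invariant set \<open>A\<close> therefore meets almost every elliptic section in a null or a conull set
  (\<open>rotation_slices\<close>, based on \<open>dense_translations_null_or_conull\<close>), so in this region \<open>A\<close> depends on
  the height alone. The third Vieta involution changes the height: in the coordinates
  \<open>(z, w)\<close> with \<open>w = - x * y - z\<close> it is the exchange of \<open>z\<close> and \<open>w\<close>, so a set that is a union of vertical
  lines is also a union of horizontal lines. Together with a sign change this makes \<open>A\<close> null or conull in the
  whole elliptic region (\<open>zero_one_elliptic_region\<close>).

  It remains to see that almost every orbit enters the elliptic region. This is a
  descent on \<open>\<bar>z\<bar>\<close> (\<open>reach_elliptic\<close>). When \<open>z > 2\<close>, one first arranges \<open>x * y < 0\<close> by moves that fix \<open>z\<close>;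
  then the third Vieta involution lowers \<open>\<bar>z\<bar>\<close> by a definite amount, unless \<open>x * y\<close> is small, in which case moves that
  fix the smaller of the two coordinates slide \<open>z\<close> into \<open>[-2, 2]\<close>. The bound \<open>c \<ge> - 12\<close> is exactly what
  prevents the involution from producing another height above 2. The only orbits
  excluded are those that meet a coordinate plane \<open>x = 0\<close> or \<open>y = 0\<close>.

  Since the generators carry charts to charts, images of null sets of parameters are null for the area
  measure (\<open>words_param_null\<close>). If \<open>A\<close> is null in the elliptic region, then countably many such
  images cover \<open>A\<close> up to the points with \<open>x = y = 0\<close>, so \<open>A\<close> is null (\<open>null_if_null_on_elliptic_region\<close>);
  otherwise the same applies to its complement.\<close>

section \<open>Descent of an orbit to the elliptic region\<close>

text \<open>The predicate \<open>S\<close> abstracts the orbit of a point. Everything in this part is real algebra: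
  the coordinate planes \<open>x = 0\<close> and \<open>y = 0\<close> are excluded because there the moves used below
  can degenerate into sign changes, so that the descent stalls.\<close>

locale closed_orbit =
  fixes S :: "real \<Rightarrow> real \<Rightarrow> real \<Rightarrow> bool" and c :: real
  assumes vieta_x: "S x y z \<Longrightarrow> S (y * z - x) y z"
    and vieta_z: "S x y z \<Longrightarrow> S x y (- x * y - z)"
    and sign_x: "S x y z \<Longrightarrow> S x (- y) (- z)"
    and sign_y: "S x y z \<Longrightarrow> S (- x) y (- z)"
    and swap: "S x y z \<Longrightarrow> S y x z"
    and level: "S x y z \<Longrightarrow> x\<^sup>2 + y\<^sup>2 - x * y * z = z\<^sup>2 - c"
    and nonzero: "S x y z \<Longrightarrow> x \<noteq> 0 \<and> y \<noteq> 0"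
    and c_less: "c < 4"
begin

lemma sign_z: "S x y z \<Longrightarrow> S (- x) (- y) z"
  using sign_x[OF sign_y, of x y z] by simp

text \<open>For fixed \<open>z > 2\<close> the level curve is a hyperbola, and while \<open>0 < y \<le> x\<close> the identity
  \<open>x * (y * z - x) = y\<^sup>2 - (z\<^sup>2 - c)\<close> shows that replacing the larger coordinate by its Vieta conjugate
  either makes it negative or lowers \<open>x + y\<close> by at least \<open>(z\<^sup>2 - c) / M\<close>.\<close>

lemma reach_opposite_signs_aux:
  assumes "z > 2" "M > 0" "S x y z" "0 < y" "y \<le> x" "x \<le> M" "x + y \<le> real n * ((z\<^sup>2 - c) / M)"
  shows "\<exists>x y. S x y z \<and> 0 < x \<and> y < 0"
  using assms(3-)
proof (induction n arbitrary: x y)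
  case 0
  then show ?case by simp
next
  case (Suc n)
  define R where "R = z\<^sup>2 - c"
  have "z\<^sup>2 > 2\<^sup>2" using assms(1) by (intro power_strict_mono) auto
  then have R: "R > 0" using c_less by (simp add: R_def)
  let ?x = "y * z - x"
  have S': "S ?x y z" by (rule vieta_x) fact
  have "?x \<noteq> 0" using nonzero[OF S'] by simp
  then consider "?x < 0" | "?x > 0" by linarith
  then show ?case
  proof cases
    case 1
    then show ?thesis using sign_z[OF S'] Suc.prems by (intro exI[of _ "- ?x"] exI[of _ "- y"]) auto
  next
    case 2
    have e: "x * ?x = y\<^sup>2 - R"
      using level[OF Suc.prems(1)] unfolding R_def by (simp add: algebra_simps power2_eq_square)
    have "y * ?x \<le> x * ?x" using 2 Suc.prems by (intro mult_right_mono) auto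
    then have "R \<le> y * (y - ?x)" using e by (simp add: algebra_simps power2_eq_square)
    moreover have p: "y - ?x > 0"
      using calculation R Suc.prems(2) by (smt (verit) mult_nonneg_nonpos)
    moreover have "y * (y - ?x) \<le> M * (y - ?x)"
      using p Suc.prems by (intro mult_right_mono) auto
    ultimately have "R \<le> M * (y - ?x)" by linarith
    then have "R / M \<le> y - ?x" using \<open>M > 0\<close> by (simp add: field_simps)
    then have "y + ?x \<le> real n * (R / M)"
      using Suc.prems unfolding R_def[symmetric] by (simp add: algebra_simps)
    then show ?thesis
      using Suc.IH[OF swap[OF S'] 2] p Suc.prems unfolding R_def by auto
  qed
qed

lemma reach_opposite_signs:
  assumes "S x y z" "z > 2"
  shows "\<exists>x y. S x y z \<and> 0 < x \<and> y < 0 \<and> - y \<le> x"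
proof -
  have *: "\<exists>x y. S x y z \<and> 0 < x \<and> y < 0" if S: "S x y z" and "0 < y" "y \<le> x" for x y
  proof -
    have "z\<^sup>2 > 2\<^sup>2" using assms(2) by (intro power_strict_mono) auto
    then have "(z\<^sup>2 - c) / x > 0" using c_less that by simp
    then obtain n where "x + y \<le> real n * ((z\<^sup>2 - c) / x)"
      using reals_Archimedean3[of "(z\<^sup>2 - c) / x"] by (meson less_imp_le)
    then show ?thesis using reach_opposite_signs_aux[OF assms(2) _ S, of x n] that by simp
  qed
  have nz: "x \<noteq> 0" "y \<noteq> 0" using nonzero[OF assms(1)] by auto
  have "\<exists>x y. S x y z \<and> 0 < x \<and> y < 0"
  proof -
    consider "x > 0" "y < 0" | "x < 0" "y > 0" | "x > 0" "y > 0" "y \<le> x" | "x > 0" "y > 0" "x \<le> y"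
      | "x < 0" "y < 0" "-y \<le> -x" | "x < 0" "y < 0" "-x \<le> -y" using nz by linarith
    then show ?thesis
      by cases (use assms(1) swap * sign_z in \<open>meson neg_0_less_iff_less\<close>)+
  qed
  then obtain x y where xy: "S x y z" "0 < x" "y < 0" by blast
  show ?thesis
  proof (cases "- y \<le> x")
    case False
    then show ?thesis using swap[OF sign_z[OF xy(1)]] xy
      by (intro exI[of _ "- y"] exI[of _ "- x"]) auto
  qed (use xy in blast)
qed

text \<open>When \<open>y\<close> is small the group elements that fix \<open>y\<close> move \<open>(x, z)\<close> along a hyperbola in short
  steps: \<open>z\<close> becomes \<open>z1 = z + x * y\<close> and \<open>x\<close> becomes \<open>x1 = x + y * z1\<close>. A step has length less than 4,
  so \<open>z\<close> cannot jump over the interval \<open>[-2, 2]\<close>; and \<open>x * x1 = z1\<^sup>2 - y\<^sup>2 - c\<close> keeps \<open>x\<close> away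
  from 0, so the steps do not shrink either.\<close>

lemma small_y_aux:
  assumes no: "\<And>x y z. S x y z \<Longrightarrow> \<bar>z\<bar> > 2"
    and y: "y < 0" "y\<^sup>2 < 4 - c"
    and "S x y z" "x > 0" "z > 2" "- (x * y) < 4" "z \<le> real n * (- y * sqrt (4 - c - y\<^sup>2))"
  shows False
  using assms(4-)
proof (induction n arbitrary: x z)
  case 0
  then show ?case by simp
next
  case (Suc n)
  define z1 where "z1 = z + x * y"
  define x1 where "x1 = x + y * z1"
  have "- x * y - z = - z1" by (simp add: z1_def)
  then have "S x y (- z1)" using vieta_z[OF Suc.prems(1)] by metis
  from no[OF this] have z1: "z1 > 2" using Suc.prems by (simp add: z1_def)
  have "S x1 y z1"
    using sign_y[OF vieta_x[OF \<open>S x y (- z1)\<close>]] by (simp add: x1_def algebra_simps)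
  have e: "x * x1 = z1\<^sup>2 - y\<^sup>2 - c"
    using level[OF Suc.prems(1)] unfolding x1_def z1_def by (simp add: algebra_simps power2_eq_square)
  have "z1\<^sup>2 > 2\<^sup>2" using z1 by (intro power_strict_mono) auto
  then have big: "x * x1 > 4 - c - y\<^sup>2" using e by simp
  then have "x * x1 > 0" using y by linarith
  then have x1: "x1 > 0" using Suc.prems by (simp add: zero_less_mult_iff)
  have lt: "x1 < x" unfolding x1_def using y z1 by (simp add: mult_neg_pos)
  have "x * x1 \<le> x * x" using lt Suc.prems by (intro mult_left_mono) auto
  then have "sqrt (4 - c - y\<^sup>2) \<le> sqrt (x\<^sup>2)" using big by (intro real_sqrt_le_mono) (simp add: power2_eq_square)
  then have s: "sqrt (4 - c - y\<^sup>2) \<le> x" using Suc.prems by simp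
  have "- y * sqrt (4 - c - y\<^sup>2) \<le> - y * x" using s y by (intro mult_left_mono) auto
  then have "z1 \<le> real n * (- y * sqrt (4 - c - y\<^sup>2))"
    using Suc.prems unfolding z1_def by (simp add: algebra_simps)
  moreover have "- (x1 * y) < 4"
  proof -
    have "x * y \<le> x1 * y" using lt y by (intro mult_right_mono_neg) auto
    then show ?thesis using Suc.prems by linarith
  qed
  ultimately show ?case using Suc.IH[OF \<open>S x1 y z1\<close> x1 z1] by blast
qed

text \<open>The third Vieta involution with \<open>x * y < 0\<close> replaces \<open>z\<close> by \<open>z' = - x * y - z\<close>. Expanding
  \<open>(x + y)\<^sup>2 \<ge> 0\<close> on the level surface gives \<open>(z + 2) * (z' + 2) \<le> 4 - c\<close>. This is where \<open>c \<ge> - 12\<close>,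
  that is \<open>k \<ge> - 14\<close>, enters: the product is at most 16, so \<open>z > 2\<close> forces \<open>z' < 2\<close>. If
  \<open>z'\<close> is not elliptic then \<open>\<bar>z'\<bar> = z - \<bar>x * y\<bar>\<close>, which is a definite decrease unless \<open>\<bar>x * y\<bar>\<close> is
  so small that the previous lemma applies.\<close>

lemma reach_elliptic_aux:
  assumes no: "\<And>x y z. S x y z \<Longrightarrow> \<bar>z\<bar> > 2" and c: "- 12 \<le> c"
    and "S x y z" "z > 2" "z \<le> real n * min 4 (4 - c)"
  shows False
  using assms(3-)
proof (induction n arbitrary: x y z)
  case 0
  then show ?case by simp
next
  case (Suc n)
  obtain x y where xy: "S x y z" "0 < x" "y < 0" "- y \<le> x"
    using reach_opposite_signs[OF Suc.prems(1,2)] by blast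
  show ?case
  proof (cases "- (x * y) < min 4 (4 - c)")
    case True
    have "y * y \<le> - (x * y)" using mult_right_mono[OF xy(4), of "- y"] xy by simp
    then have y2: "y\<^sup>2 < 4 - c" using True by (simp add: power2_eq_square)
    then have "- y * sqrt (4 - c - y\<^sup>2) > 0" using xy by (intro mult_pos_pos) auto
    then obtain m where "z \<le> real m * (- y * sqrt (4 - c - y\<^sup>2))"
      using reals_Archimedean3 by (meson less_imp_le)
    then show ?thesis
      using small_y_aux[OF _ xy(3) y2 xy(1,2) Suc.prems(2)] no True by simp
  next
    case False
    let ?z = "- x * y - z"
    have S': "S x y ?z" by (rule vieta_z) fact
    have "0 \<le> (x + y)\<^sup>2" by simp
    then have "(z + 2) * (?z + 2) \<le> 4 - c"
      using level[OF xy(1)] by (simp add: algebra_simps power2_eq_square)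
    then have le: "(z + 2) * (?z + 2) \<le> 16" using c by simp
    have "?z < 2"
    proof (rule ccontr)
      assume "\<not> ?z < 2"
      then have "(z + 2) * 4 \<le> (z + 2) * (?z + 2)" using Suc.prems by (intro mult_left_mono) auto
      then have "(z + 2) * 4 \<le> 16" using le by (rule order_trans)
      then have "z + 2 \<le> 4" by simp
      then show False using Suc.prems(2) by simp
    qed
    then have "- ?z > 2" using no[OF S'] by linarith
    moreover have "- ?z \<le> real n * min 4 (4 - c)"
    proof -
      define d where "d = min 4 (4 - c)"
      have "d \<le> - (x * y)" "z \<le> d + real n * d"
        using False Suc.prems(3) unfolding d_def[symmetric] by (simp_all add: algebra_simps)
      then show ?thesis unfolding d_def[symmetric] by linarith
    qed
    ultimately show ?thesis using Suc.IH[OF sign_x[OF S']] by blast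
  qed
qed

lemma reach_elliptic:
  assumes c: "- 12 \<le> c" and S: "S x y z"
  shows "\<exists>x y z. S x y z \<and> \<bar>z\<bar> \<le> 2"
proof (rule ccontr)
  assume "\<not> ?thesis"
  then have no: "\<bar>z\<bar> > 2" if "S x y z" for x y z using that by (meson not_le)
  obtain x y z where *: "S x y z" "z > 2"
  proof (cases "z > 2")
    case False
    then have "- z > 2" using no[OF S] by linarith
    then show thesis using that sign_x[OF S] by blast
  qed (use that S in blast)
  have "min 4 (4 - c) > 0" using c_less by simp
  then obtain m where "z \<le> real m * min 4 (4 - c)"
    using reals_Archimedean3 by (meson less_imp_le)
  then show False using reach_elliptic_aux[OF _ c *] no by blast
qed

end

section \<open>Sets of reals with a dense group of translations\<close>

text \<open>This is the ergodicity of irrational rotations, lifted to the line. The measure of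
  \<open>A \<inter> {a<..b}\<close> varies continuously under translation of the interval, so invariance under a dense
  set of translations makes it depend on \<open>b - a\<close> only; being additive and monotone it equals
  \<open>C * (b - a)\<close>. If \<open>C > 0\<close>, the measure \<open>X \<mapsto> \<lambda> (A \<inter> X) / C\<close> agrees with Lebesgue measure on intervals,
  hence everywhere, and gives \<open>- A\<close> mass 0.\<close>

lemma dense_translations_null_or_conull:
  fixes A :: "real set"
  assumes A: "A \<in> sets borel"
    and dense: "\<And>t e. e > 0 \<Longrightarrow> \<exists>d. \<bar>d - t\<bar> < e \<and> (\<forall>x. x + d \<in> A \<longleftrightarrow> x \<in> A)"
  shows "A \<in> null_sets lborel \<or> - A \<in> null_sets lborel"
proof -
  define m where "m a b = measure lebesgue (A \<inter> {a<..b})" for a b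
  have fm: "A \<inter> {a<..b} \<in> lmeasurable" for a b
  proof (rule bounded_set_imp_lmeasurable)
    show "bounded (A \<inter> {a<..b})" by (rule bounded_subset[of "{a..b}"]) auto
    show "A \<inter> {a<..b} \<in> sets lebesgue" using A by (intro sets_completionI_sets) auto
  qed
  have add: "m a c = m a b + m b c" if "a \<le> b" "b \<le> c" for a b c
  proof -
    have "A \<inter> {a<..c} = (A \<inter> {a<..b}) \<union> (A \<inter> {b<..c})" using that by auto
    moreover have "(A \<inter> {a<..b}) \<inter> (A \<inter> {b<..c}) = {}" by auto
    ultimately show ?thesis unfolding m_def
      using measure_Un3[OF fm fm, of a b b c] by simp
  qed
  have bd: "0 \<le> m a b" "m a b \<le> b - a" if "a \<le> b" for a b
  proof -
    have "bounded {a<..b}" by (rule bounded_subset[of "{a..b}"]) auto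
    then have Ioc: "{a<..b} \<in> lmeasurable" by (rule bounded_set_imp_lmeasurable) simp
    have "m a b \<le> measure lebesgue {a<..b}"
      unfolding m_def by (rule measure_mono_fmeasurable) (use fm[of a b] Ioc in auto)
    then show "m a b \<le> b - a" using that by simp
  qed (simp add: m_def)
  have near: "\<bar>m (a + s) (b + s) - m a b\<bar> \<le> s" if "a \<le> b" "s \<ge> 0" for a b s
    using add[of a b "b + s"] add[of a "a + s" "b + s"] bd[of b "b + s"] bd[of a "a + s"] that by auto
  have near': "\<bar>m (a + s) (b + s) - m a b\<bar> \<le> \<bar>s\<bar>" if "a \<le> b" for a b s
    using near[OF that, of s] near[of "a + s" "b + s" "- s"] that by (cases "s \<ge> 0") auto
  have exact: "m (a + d) (b + d) = m a b" if "\<forall>x. x + d \<in> A \<longleftrightarrow> x \<in> A" for a b d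
  proof -
    have "A \<inter> {a + d<..b + d} = (+) d ` (A \<inter> {a<..b})"
    proof (intro equalityI subsetI)
      fix x assume "x \<in> A \<inter> {a + d<..b + d}"
      then show "x \<in> (+) d ` (A \<inter> {a<..b})"
        using that[rule_format, of "x - d"] by (intro image_eqI[of _ _ "x - d"]) auto
    qed (use that in \<open>auto simp: add.commute\<close>)
    then show ?thesis unfolding m_def by (simp add: measure_translation)
  qed
  have trans: "m (a + t) (b + t) = m a b" if "a \<le> b" for a b t
  proof -
    have "\<bar>m (a + t) (b + t) - m a b\<bar> \<le> e" if e: "e > 0" for e
    proof -
      obtain d where d: "\<bar>d - t\<bar> < e" "\<forall>x. x + d \<in> A \<longleftrightarrow> x \<in> A" using dense[OF e] by blast
      then show ?thesis
        using near'[of "a + t" "b + t" "d - t"] exact[OF d(2), of a b] \<open>a \<le> b\<close> by (simp add: algebra_simps)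
    qed
    then have "\<bar>m (a + t) (b + t) - m a b\<bar> \<le> 0" by (rule field_le_epsilon) simp
    then show ?thesis by simp
  qed
  define C where "C = m 0 1"
  have mult: "m 0 (real n * t) = real n * m 0 t" if "t \<ge> 0" for n t
  proof (induction n)
    case 0 then show ?case by (simp add: m_def)
  next
    case (Suc n)
    have "m 0 (real (Suc n) * t) = m 0 (real n * t) + m (real n * t) (real n * t + t)"
      using that by (subst add[of 0 "real n * t"]) (auto simp: algebra_simps)
    also have "m (real n * t) (real n * t + t) = m 0 t"
      using trans[of 0 t "real n * t"] that by (simp add: add.commute)
    finally show ?case using Suc by (simp add: algebra_simps)
  qed
  have lin0: "m 0 t = t * C" if t: "t \<ge> 0" for t
  proof -
    have "real n * \<bar>m 0 t - t * C\<bar> \<le> C" for n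
    proof -
      define k where "k = nat \<lfloor>real n * t\<rfloor>"
      have k: "real k \<le> real n * t" "real n * t \<le> real (Suc k)"
        using t unfolding k_def by (auto simp: of_nat_floor) linarith
      have "real k * C \<le> real n * m 0 t"
        using mult[OF t, of n] mult[of 1 k] add[of 0 "real k" "real n * t"] bd[of "real k" "real n * t"] k
        by (simp add: C_def)
      moreover have "real n * m 0 t \<le> real (Suc k) * C"
        using mult[OF t, of n] mult[of 1 "Suc k"] add[of 0 "real n * t" "real (Suc k)"]
          bd[of "real n * t" "real (Suc k)"] k t by (simp add: C_def)
      moreover have "real k * C \<le> real n * t * C" "real n * t * C \<le> real (Suc k) * C"
        using k bd(1)[of 0 1] by (auto simp: C_def intro!: mult_right_mono simp del: of_nat_Suc)
      ultimately have "\<bar>real n * m 0 t - real n * t * C\<bar> \<le> C" by (simp add: algebra_simps abs_le_iff)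
      also have "real n * m 0 t - real n * t * C = real n * (m 0 t - t * C)" by (simp add: algebra_simps)
      finally show ?thesis by (simp add: abs_mult)
    qed
    then have "\<bar>m 0 t - t * C\<bar> \<le> 0"
      using reals_Archimedean3[of "\<bar>m 0 t - t * C\<bar>"] by (metis not_le)
    then show ?thesis by simp
  qed
  have lin: "m a b = (b - a) * C" if "a \<le> b" for a b
    using lin0[of "b - a"] trans[of 0 "b - a" a] that by simp
  have em: "emeasure lborel (A \<inter> {a<..<b}) = ennreal ((b - a) * C)" if "a \<le> b" for a b
  proof -
    have "emeasure lborel (A \<inter> {a<..<b}) = emeasure lborel (A \<inter> {a<..b})"
    proof (cases "a < b")
      case True
      have "emeasure lborel (A \<inter> {a<..b} - {b}) = emeasure lborel (A \<inter> {a<..b})"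
        using A by (intro emeasure_Diff_null_set) auto
      moreover have "A \<inter> {a<..b} - {b} = A \<inter> {a<..<b}" by auto
      ultimately show ?thesis by simp
    qed (use that in auto)
    also have "\<dots> = emeasure lebesgue (A \<inter> {a<..b})" using A by simp
    also have "\<dots> = ennreal (m a b)" unfolding m_def by (rule emeasure_eq_measure2[OF fm])
    finally show ?thesis using lin[OF that] by simp
  qed
  show ?thesis
  proof (cases "C = 0")
    case True
    have "(\<Union>n::nat. A \<inter> {- real n<..<real n}) \<in> null_sets lborel"
      by (rule null_sets_UN) (use em A True in \<open>auto intro!: null_setsI\<close>)
    moreover have "(\<Union>n::nat. A \<inter> {- real n<..<real n}) = A"
    proof -
      have "\<exists>n::nat. - real n < x \<and> x < real n" for x
      proof -
        obtain n :: nat where "\<bar>x\<bar> < real n" using reals_Archimedean2 by blast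
        then show ?thesis by (intro exI[of _ n]) linarith
      qed
      then show ?thesis by auto
    qed
    ultimately show ?thesis by simp
  next
    case False
    then have C: "C > 0" using bd(1)[of 0 1] by (simp add: C_def)
    define N where "N = scale_measure (ennreal (1 / C)) (density lborel (indicator A))"
    have N: "emeasure N X = ennreal (1 / C) * emeasure lborel (A \<inter> X)" if "X \<in> sets borel" for X
      using A that unfolding N_def 
      by (simp add: emeasure_density indicator_inter_arith[symmetric])
    have "lborel = N"
    proof (rule lborel_eqI)
      fix l u :: real assume "\<And>b. b \<in> Basis \<Longrightarrow> l \<bullet> b \<le> u \<bullet> b"
      then have "l \<le> u" by simp
      have "ennreal (1 / C) * ennreal ((u - l) * C) = ennreal (u - l)"
        using C \<open>l \<le> u\<close> by (simp add: ennreal_mult[symmetric])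
      then show "emeasure N (box l u) = ennreal (\<Prod>b\<in>Basis. (u - l) \<bullet> b)"
        using em[OF \<open>l \<le> u\<close>] by (simp add: N)
    qed (simp add: N_def)
    then have "emeasure lborel (- A) = 0" using N[of "- A"] A by simp
    then show ?thesis using A by (intro disjI2 null_setsI) auto
  qed
qed

section \<open>Null sets on the line and in the plane\<close>

lemma null_sets_prod_iff:
  fixes K :: "(real \<times> real) set"
  assumes "K \<in> sets borel"
  shows "K \<in> null_sets lborel \<longleftrightarrow> (AE z in lborel. Pair z -` K \<in> null_sets lborel)"
proof -
  have K: "K \<in> sets (lborel \<Otimes>\<^sub>M lborel)" using assms unfolding lborel_prod by simp
  have "emeasure lborel K = (\<integral>\<^sup>+z. emeasure lborel (Pair z -` K) \<partial>lborel)"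
    using lborel.emeasure_pair_measure_alt[OF K] by (simp add: lborel_prod)
  moreover have "(\<lambda>z. emeasure lborel (Pair z -` K)) \<in> borel_measurable lborel"
    using lborel.measurable_emeasure_Pair[OF K] .
  moreover have "Pair z -` K \<in> sets lborel" for z using sets_Pair1[OF K] .
  ultimately show ?thesis using assms
    by (auto simp: null_sets_def nn_integral_0_iff_AE)
qed

lemma null_sets_swap:
  fixes K :: "(real \<times> real) set"
  assumes "K \<in> null_sets lborel"
  shows "prod.swap -` K \<in> null_sets lborel"
proof -
  have K: "K \<in> sets (lborel \<Otimes>\<^sub>M lborel)" using assms unfolding lborel_prod by auto
  have "(prod.swap :: real \<times> real \<Rightarrow> _) \<in> borel_measurable borel"
    by (intro borel_measurable_continuous_onI continuous_on_swap)
  then have S: "prod.swap -` K \<in> sets borel"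
    using assms measurable_sets_borel[of prod.swap borel K] by auto
  then have "prod.swap -` K \<in> sets (lborel \<Otimes>\<^sub>M lborel)" unfolding lborel_prod by simp
  from lborel.emeasure_pair_measure_alt[OF this]
  have "emeasure lborel (prod.swap -` K) = (\<integral>\<^sup>+x. emeasure lborel (Pair x -` (prod.swap -` K)) \<partial>lborel)"
    by (simp add: lborel_prod)
  also have "\<dots> = (\<integral>\<^sup>+x. emeasure lborel ((\<lambda>y. (y, x)) -` K) \<partial>lborel)"
    by (simp add: vimage_def)
  also have "\<dots> = emeasure lborel K"
    using lborel_pair.emeasure_pair_measure_alt2[OF K] by (simp add: lborel_prod)
  finally show ?thesis using assms S by (auto simp: null_sets_def)
qed

lemma null_sets_uminus_iff:
  fixes A :: "real set"
  shows "uminus -` A \<in> null_sets lborel \<longleftrightarrow> A \<in> null_sets lborel"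
proof -
  have "uminus -` A \<in> null_sets lborel" if "A \<in> null_sets lborel" for A :: "real set"
  proof -
    have A: "A \<in> sets borel" "emeasure lborel A = 0" using that by auto
    have "emeasure (distr lborel borel uminus) A = emeasure lborel (uminus -` A)"
      using A by (subst emeasure_distr) auto
    moreover have "uminus -` A \<in> sets borel" using A measurable_sets_borel[of uminus borel A] by simp
    ultimately show ?thesis using A by (auto simp: lborel_distr_uminus)
  qed
  from this[of A] this[of "uminus -` A"] show ?thesis by (auto simp: vimage_def)
qed

text \<open>The points near which \<open>B\<close> is null and those near which it is conull form two disjoint open sets
  covering the connected set \<open>I\<close>, so one of them is empty.\<close>

lemma locally_null_connected:
  fixes B I :: "real set"
  assumes "connected I" and open_I: "open I" and B: "B \<in> sets borel"
    and loc: "\<And>x. x \<in> I \<Longrightarrow> \<exists>e>0. ball x e \<subseteq> I \<and> (negligible (ball x e \<inter> B) \<or> negligible (ball x e - B))"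
  shows "negligible (I \<inter> B) \<or> negligible (I - B)"
proof -
  define U V where "U = {x\<in>I. \<exists>e>0. ball x e \<subseteq> I \<and> negligible (ball x e \<inter> B)}"
    and "V = {x\<in>I. \<exists>e>0. ball x e \<subseteq> I \<and> negligible (ball x e - B)}"
  have sub: "\<exists>d>0. ball y d \<subseteq> ball x e" if "y \<in> ball x e" for x y e :: real
    using that open_ball open_contains_ball by blast
  have oU: "open U" unfolding open_contains_ball
  proof safe
    fix x assume "x \<in> U"
    then obtain e where e: "e > 0" "ball x e \<subseteq> I" "negligible (ball x e \<inter> B)" by (auto simp: U_def)
    have "ball x e \<subseteq> U"
    proof
      fix y assume y: "y \<in> ball x e"
      obtain d where d: "d > 0" "ball y d \<subseteq> ball x e" using sub[OF y] by blast
      have "negligible (ball y d \<inter> B)" by (rule negligible_subset[OF e(3)]) (use d(2) in blast)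
      moreover have "ball y d \<subseteq> I" "y \<in> I" using d(2) e(2) y by blast+
      ultimately show "y \<in> U" unfolding U_def using d(1) by blast
    qed
    then show "\<exists>e>0. ball x e \<subseteq> U" using e by blast
  qed
  have oV: "open V" unfolding open_contains_ball
  proof safe
    fix x assume "x \<in> V"
    then obtain e where e: "e > 0" "ball x e \<subseteq> I" "negligible (ball x e - B)" by (auto simp: V_def)
    have "ball x e \<subseteq> V"
    proof
      fix y assume y: "y \<in> ball x e"
      obtain d where d: "d > 0" "ball y d \<subseteq> ball x e" using sub[OF y] by blast
      have "negligible (ball y d - B)" by (rule negligible_subset[OF e(3)]) (use d(2) in blast)
      moreover have "ball y d \<subseteq> I" "y \<in> I" using d(2) e(2) y by blast+
      ultimately show "y \<in> V" unfolding V_def using d(1) by blast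
    qed
    then show "\<exists>e>0. ball x e \<subseteq> V" using e by blast
  qed
  have cov: "I \<subseteq> U \<union> V" unfolding U_def V_def using loc by blast
  have dis: "U \<inter> V \<inter> I = {}"
  proof (rule ccontr)
    assume "U \<inter> V \<inter> I \<noteq> {}"
    then obtain x where "x \<in> U" "x \<in> V" by blast
    then obtain d e where "d > 0" "e > 0" "negligible (ball x d \<inter> B)" "negligible (ball x e - B)"
      unfolding U_def V_def by blast
    then have "negligible ((ball x d \<inter> B) \<union> (ball x e - B))" by (intro negligible_Un)
    then have "negligible (ball x (min d e))" by (rule negligible_subset) auto
    then show False using \<open>d > 0\<close> \<open>e > 0\<close> open_not_negligible[of "ball x (min d e)"] by simp
  qed
  have "U \<inter> I = {} \<or> V \<inter> I = {}" by (rule connectedD[OF \<open>connected I\<close> oU oV dis cov])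
  moreover have "negligible (I - B)" if "U \<inter> I = {}"
  proof (rule locally_negligible_alt[THEN iffD2], rule ballI)
    fix x assume x: "x \<in> I - B"
    then have "x \<in> I" by blast
    then obtain e where e: "e > 0" "ball x e \<subseteq> I" "negligible (ball x e \<inter> B) \<or> negligible (ball x e - B)"
      using loc by meson
    moreover have "x \<notin> U" using that \<open>x \<in> I\<close> by blast
    ultimately have neg: "negligible (ball x e - B)" unfolding U_def using \<open>x \<in> I\<close> by auto
    have "openin (top_of_set (I - B)) ((I - B) \<inter> ball x e)" by (simp add: openin_open_Int)
    moreover have "negligible ((I - B) \<inter> ball x e)" by (rule negligible_subset[OF neg]) auto
    ultimately show "\<exists>U. openin (top_of_set (I - B)) U \<and> x \<in> U \<and> negligible U"
      using x e by (intro exI[of _ "(I - B) \<inter> ball x e"]) simp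
  qed
  moreover have "negligible (I \<inter> B)" if "V \<inter> I = {}"
  proof (rule locally_negligible_alt[THEN iffD2], rule ballI)
    fix x assume x: "x \<in> I \<inter> B"
    then have "x \<in> I" by blast
    then obtain e where e: "e > 0" "ball x e \<subseteq> I" "negligible (ball x e \<inter> B) \<or> negligible (ball x e - B)"
      using loc by meson
    moreover have "x \<notin> V" using that \<open>x \<in> I\<close> by blast
    ultimately have neg: "negligible (ball x e \<inter> B)" unfolding V_def using \<open>x \<in> I\<close> by auto
    have "openin (top_of_set (I \<inter> B)) ((I \<inter> B) \<inter> ball x e)" by (simp add: openin_open_Int)
    moreover have "negligible ((I \<inter> B) \<inter> ball x e)" by (rule negligible_subset[OF neg]) auto
    ultimately show "\<exists>U. openin (top_of_set (I \<inter> B)) U \<and> x \<in> U \<and> negligible U"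
      using x e by (intro exI[of _ "(I \<inter> B) \<inter> ball x e"]) simp
  qed
  ultimately show ?thesis by blast
qed

section \<open>Coordinates exchanged by the third Vieta involution\<close>

text \<open>On the level surface with \<open>c = k + 2\<close>, put \<open>w = - x * y - z\<close> for the image of the coordinate
  \<open>z\<close> under the third Vieta involution. Then \<open>x * y = - (z + w)\<close> and \<open>x\<^sup>2 + y\<^sup>2 = - c - z * w\<close>, so that
  \<open>(x + y)\<^sup>2\<close> and \<open>(x - y)\<^sup>2\<close> are the two polynomials below. The pair \<open>(z, w)\<close> therefore parametrizes the
  quarter \<open>\<bar>y\<bar> < x\<close> of the surface; the third Vieta involution becomes the exchange of \<open>z\<close> and \<open>w\<close>, and
  the sign change \<open>(x, - y, - z)\<close> becomes \<open>(- z, - w)\<close>.\<close>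

definition sq_sum :: "real \<Rightarrow> real \<Rightarrow> real \<Rightarrow> real" where
  "sq_sum c z w = 4 - c - (z + 2) * (w + 2)"

definition sq_diff :: "real \<Rightarrow> real \<Rightarrow> real \<Rightarrow> real" where
  "sq_diff c z w = 4 - c - (z - 2) * (w - 2)"

definition param_dom :: "real \<Rightarrow> (real \<times> real) set" where
  "param_dom c = {(z, w). 0 < sq_sum c z w \<and> 0 < sq_diff c z w}"

definition param :: "real \<Rightarrow> real \<times> real \<Rightarrow> real^3" where
  "param c = (\<lambda>(z, w). vector [(sqrt (sq_sum c z w) + sqrt (sq_diff c z w)) / 2,
     (sqrt (sq_sum c z w) - sqrt (sq_diff c z w)) / 2, z])"

lemma sq_sum_commute: "sq_sum c z w = sq_sum c w z" and sq_diff_commute: "sq_diff c z w = sq_diff c w z"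
  by (simp_all add: sq_sum_def sq_diff_def algebra_simps)

lemma sq_sum_minus: "sq_sum c (- z) (- w) = sq_diff c z w" and sq_diff_minus: "sq_diff c (- z) (- w) = sq_sum c z w"
  by (simp_all add: sq_sum_def sq_diff_def algebra_simps)

lemma param_nth [simp]:
  "param c (z, w) $ 1 = (sqrt (sq_sum c z w) + sqrt (sq_diff c z w)) / 2"
  "param c (z, w) $ 2 = (sqrt (sq_sum c z w) - sqrt (sq_diff c z w)) / 2"
  "param c (z, w) $ 3 = z"
  by (simp_all add: param_def)

lemma param_dom_iff: "(z, w) \<in> param_dom c \<longleftrightarrow> 0 < sq_sum c z w \<and> 0 < sq_diff c z w"
  by (simp add: param_dom_def)

lemma
  assumes "(z, w) \<in> param_dom c"
  shows param_level: "(param c (z, w) $ 1)\<^sup>2 + (param c (z, w) $ 2)\<^sup>2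
      - param c (z, w) $ 1 * param c (z, w) $ 2 * z = z\<^sup>2 - c"
    and param_vieta: "- param c (z, w) $ 1 * param c (z, w) $ 2 - z = w"
proof -
  define s t where "s = sqrt (sq_sum c z w)" and "t = sqrt (sq_diff c z w)"
  have st: "s\<^sup>2 = sq_sum c z w" "t\<^sup>2 = sq_diff c z w" using assms by (simp_all add: s_def t_def param_dom_iff)
  have "(s + t) / 2 * ((s - t) / 2) = (s\<^sup>2 - t\<^sup>2) / 4"
    by (simp add: field_simps power2_eq_square)
  also have "\<dots> = - (z + w)" unfolding st sq_sum_def sq_diff_def by (simp add: field_simps)
  finally have e: "(s + t) / 2 * ((s - t) / 2) = - (z + w)" .
  have "- param c (z, w) $ 1 * param c (z, w) $ 2 - z = - ((s + t) / 2 * ((s - t) / 2)) - z"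
    by (simp add: s_def t_def)
  then show "- param c (z, w) $ 1 * param c (z, w) $ 2 - z = w"
    unfolding e by simp
  have "((s + t) / 2)\<^sup>2 + ((s - t) / 2)\<^sup>2 = (s\<^sup>2 + t\<^sup>2) / 2"
    by (simp add: field_simps power2_eq_square)
  also have "\<dots> = - c - z * w" unfolding st sq_sum_def sq_diff_def by (simp add: field_simps)
  finally have e': "((s + t) / 2)\<^sup>2 + ((s - t) / 2)\<^sup>2 = - c - z * w" .
  have "(param c (z, w) $ 1)\<^sup>2 + (param c (z, w) $ 2)\<^sup>2 - param c (z, w) $ 1 * param c (z, w) $ 2 * z
      = (((s + t) / 2)\<^sup>2 + ((s - t) / 2)\<^sup>2) - ((s + t) / 2 * ((s - t) / 2)) * z"
    by (simp add: s_def t_def)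
  then show "(param c (z, w) $ 1)\<^sup>2 + (param c (z, w) $ 2)\<^sup>2
      - param c (z, w) $ 1 * param c (z, w) $ 2 * z = z\<^sup>2 - c"
    unfolding e e' by (simp add: power2_eq_square algebra_simps)
qed

lemma continuous_on_param: "continuous_on A (param c)"
proof -
  have "continuous_on A (\<lambda>q. param c q $ i)" for i
    using exhaust_3[of i] unfolding param_def sq_sum_def sq_diff_def case_prod_beta
    by (elim disjE) (auto intro!: continuous_intros)
  then have "continuous_on A (\<lambda>q. \<chi> i. param c q $ i)" by (rule continuous_on_vec_lambda)
  then show ?thesis by simp
qed

lemma open_param_dom: "open (param_dom c)"
  unfolding param_dom_def sq_sum_def sq_diff_def case_prod_beta
  by (intro open_Collect_conj open_Collect_less continuous_intros)

lemma param_dom_elliptic: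
  assumes "(z, w) \<in> param_dom c" "\<bar>z\<bar> < 2"
  shows "c < z\<^sup>2"
proof -
  define x y where "x = param c (z, w) $ 1" and "y = param c (z, w) $ 2"
  have "x > \<bar>y\<bar>" using assms by (auto simp: x_def y_def param_dom_iff abs_less_iff)
  have "\<bar>x * y * z\<bar> \<le> \<bar>x * y\<bar> * 2" using assms(2) unfolding abs_mult by (intro mult_left_mono) auto
  also have "\<bar>x * y\<bar> * 2 < x\<^sup>2 + y\<^sup>2"
  proof -
    have "0 < (x - \<bar>y\<bar>)\<^sup>2" using \<open>x > \<bar>y\<bar>\<close> by simp
    then show ?thesis using \<open>x > \<bar>y\<bar>\<close> by (simp add: power2_eq_square algebra_simps abs_mult)
  qed
  finally show ?thesis using param_level[OF assms(1)] unfolding x_def[symmetric] y_def[symmetric] by linarith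
qed

section \<open>Rotations of the elliptic level curves\<close>

text \<open>The ellipse \<open>x\<^sup>2 + y\<^sup>2 - x * y * z = const\<close> with \<open>z = 2 * cos a\<close> is parametrized by
  \<open>x = r * cos t\<close>, \<open>y = r * cos (t + a)\<close>; the map \<open>(x, y) \<mapsto> (y, y * z - x)\<close> is then the translation
  of \<open>t\<close> by \<open>a\<close>.\<close>

lemma ellipse_point:
  fixes x y z a r :: real
  assumes z: "z = 2 * cos a" and s: "sin a \<noteq> 0" and r: "r > 0" "(r * sin a)\<^sup>2 = x\<^sup>2 + y\<^sup>2 - x * y * z"
  shows "\<exists>t. x = r * cos t \<and> y = r * cos (t + a)"
proof -
  define u v where "u = x / r" and "v = (x / r * cos a - y / r) / sin a"
  have "((x / r)\<^sup>2 + ((x / r * k - y / r) / h)\<^sup>2) * (r * h)\<^sup>2 = x\<^sup>2 * (h\<^sup>2 + k\<^sup>2) + y\<^sup>2 - x * y * (2 * k)"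
    if "h \<noteq> 0" for h k :: real
    using that r(1) by (simp add: field_simps power2_eq_square)
  from this[OF s, of "cos a"]
  have "(u\<^sup>2 + v\<^sup>2) * (r * sin a)\<^sup>2 = (r * sin a)\<^sup>2" using r(2) by (simp add: z u_def v_def)
  then have "u\<^sup>2 + v\<^sup>2 = 1" using s r(1) by simp
  then obtain t where t: "u = cos t" "v = sin t" by (rule sincos_total_2pi) auto
  have "r * cos (t + a) = r * (u * cos a - v * sin a)" by (simp add: t cos_add)
  also have "\<dots> = y" unfolding u_def v_def using s r(1) by (simp add: field_simps)
  finally show ?thesis using t r(1) by (intro exI[of _ t]) (auto simp: u_def field_simps)
qed

text \<open>Along the ellipse at height \<open>z = 2 * cos a\<close> the set \<open>A\<close> becomes a set of angles \<open>t\<close> invariant under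
  translation by \<open>a\<close> and by \<open>2 * pi\<close>. For irrational \<open>a / (2 * pi)\<close> these translations are dense, so the
  set of angles is null or conull. The coordinate \<open>w\<close> is a differentiable function of \<open>t\<close>, and
  such functions map null sets to null sets; it is not injective, so both the slice and its
  complement in the parameter domain have to be covered by images.\<close>

lemma rotation_slices:
  assumes A: "A \<in> sets borel" and inv: "\<And>p. vector [p$2, p$2 * p$3 - p$1, p$3] \<in> A \<longleftrightarrow> p \<in> A"
    and z: "\<bar>z\<bar> < 2" and irr: "arccos (z / 2) / (2 * pi) \<notin> \<rat>"
  shows "negligible {w. (z, w) \<in> param_dom c \<and> param c (z, w) \<in> A} \<or>
    negligible {w. (z, w) \<in> param_dom c \<and> param c (z, w) \<notin> A}"
proof (cases "c < z\<^sup>2")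
  case False
  then have "{w. (z, w) \<in> param_dom c \<and> param c (z, w) \<in> A} = {}" using param_dom_elliptic z by auto
  then show ?thesis by (metis negligible_empty)
next
  case True
  define a where "a = arccos (z / 2)"
  have a: "0 < a" "a < pi" "z = 2 * cos a" using z by (auto simp: a_def arccos_lt_bounded)
  then have s: "sin a > 0" by (intro sin_gt_zero)
  define r where "r = sqrt (z\<^sup>2 - c) / sin a"
  have r: "r > 0" "(r * sin a)\<^sup>2 = z\<^sup>2 - c" using True s by (auto simp: r_def)
  define e :: "real \<Rightarrow> real^3" where "e t = vector [r * cos t, r * cos (t + a), z]" for t
  define X where "X = {t. e t \<in> A}"
  have "continuous_on UNIV (\<lambda>t. e t $ i)" for i
    using exhaust_3[of i] unfolding e_def by (elim disjE) (auto intro!: continuous_intros)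
  then have "continuous_on UNIV (\<lambda>t. \<chi> i. e t $ i)" by (rule continuous_on_vec_lambda)
  then have "e \<in> borel_measurable borel" by (intro borel_measurable_continuous_onI) simp
  then have X: "X \<in> sets borel" unfolding X_def using measurable_sets_borel[OF _ A, of e] by (simp add: vimage_def)
  have step: "t + a \<in> X \<longleftrightarrow> t \<in> X" for t
  proof -
    have "cos (t + a + a) + cos t = 2 * cos a * cos (t + a)"
      using cos_add[of "t + a" a] cos_diff[of "t + a" a] by simp
    then have "r * cos (t + a + a) = r * cos (t + a) * (2 * cos a) - r * cos t" by algebra
    then have "e (t + a) = vector [e t $ 2, e t $ 2 * e t $ 3 - e t $ 1, e t $ 3]"
      unfolding e_def a(3) by (simp add: vec_eq_iff forall_3)
    then show ?thesis unfolding X_def using inv[of "e t"] by simp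
  qed
  have steps: "t + real n * a \<in> X \<longleftrightarrow> t \<in> X" for t n
  proof (induction n)
    case (Suc n)
    have "t + real (Suc n) * a = t + real n * a + a" by (simp add: algebra_simps)
    then show ?case by (simp only: step Suc)
  qed simp
  have period: "t + of_int h * (2 * pi) \<in> X \<longleftrightarrow> t \<in> X" for t h
    using cos.plus_of_int[of t h] cos.plus_of_int[of "t + a" h]
    by (simp add: X_def e_def algebra_simps)
  have "\<exists>d. \<bar>d - t\<bar> < eps \<and> (\<forall>x. x + d \<in> X \<longleftrightarrow> x \<in> X)" if "eps > 0" for t eps
  proof -
    have "eps / (2 * pi) > 0" using that by simp
    then obtain h k where k: "k > 0" "\<bar>of_int k * (a / (2 * pi)) - of_int h - t / (2 * pi)\<bar> < eps / (2 * pi)"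
      by (rule sequence_of_fractional_parts_is_dense[OF irr[folded a_def], of _ "t / (2 * pi)"])
    define n where "n = nat k"
    define d where "d = real n * a - of_int h * (2 * pi)"
    have "of_int k = real n" using k(1) by (simp add: n_def)
    then have "of_int k * (a / (2 * pi)) - of_int h - t / (2 * pi) = (d - t) / (2 * pi)"
      by (simp add: d_def field_simps)
    then have "\<bar>of_int k * (a / (2 * pi)) - of_int h - t / (2 * pi)\<bar> = \<bar>(d - t) / (2 * pi)\<bar>" by simp
    also have "\<dots> = \<bar>d - t\<bar> / (2 * pi)" by simp
    finally have "\<bar>d - t\<bar> < eps" using k(2) by (simp add: divide_less_cancel)
    moreover have "x + d \<in> X \<longleftrightarrow> x \<in> X" for x
      using steps[of x n] period[of "x + d" h] by (simp add: d_def)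
    ultimately show ?thesis by blast
  qed
  then have "X \<in> null_sets lborel \<or> - X \<in> null_sets lborel"
    by (rule dense_translations_null_or_conull[OF X])
  then have neg: "negligible X \<or> negligible (- X)"
    by (auto simp: negligible_iff_null_sets intro: null_sets_completionI)
  define f where "f t = - (r * cos t) * (r * cos (t + a)) - z" for t
  have img: "negligible (f ` Y)" if "negligible Y" for Y
  proof (rule negligible_differentiable_image_negligible[OF order_refl that])
    have "(f has_real_derivative r * sin t * (r * cos (t + a)) + r * cos t * (r * sin (t + a))) (at t)" for t
      unfolding f_def by (auto intro!: derivative_eq_intros)
    then show "f differentiable_on Y"
      by (intro differentiable_at_imp_differentiable_on) (auto simp: real_differentiable_def)
  qed
  have sub: "\<exists>t. e t = param c (z, w) \<and> w = f t" if w: "(z, w) \<in> param_dom c" for w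
  proof -
    obtain t where t: "param c (z, w) $ 1 = r * cos t" "param c (z, w) $ 2 = r * cos (t + a)"
      using ellipse_point[OF a(3) _ r(1), of "param c (z, w) $ 1" "param c (z, w) $ 2"]
        param_level[OF w] r(2) s by (auto simp del: param_nth)
    then have "e t = param c (z, w)"
      unfolding e_def vec_eq_iff forall_3 using param_nth(3)[of c z w] by simp
    moreover have "w = f t" using param_vieta[OF w] t unfolding f_def by simp
    ultimately show ?thesis by blast
  qed
  have "{w. (z, w) \<in> param_dom c \<and> param c (z, w) \<in> A} \<subseteq> f ` X"
    "{w. (z, w) \<in> param_dom c \<and> param c (z, w) \<notin> A} \<subseteq> f ` (- X)"
    using sub unfolding X_def by (auto, (metis (mono_tags) image_eqI mem_Collect_eq ComplI CollectD)+)
  then show ?thesis using neg img negligible_subset by blast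
qed

lemma countable_rational_rotation: "countable {z. \<bar>z\<bar> < 2 \<and> arccos (z / 2) / (2 * pi) \<in> \<rat>}"
proof (rule countable_subset)
  show "{z. \<bar>z\<bar> < 2 \<and> arccos (z / 2) / (2 * pi) \<in> \<rat>} \<subseteq> (\<lambda>q. 2 * cos (q * (2 * pi))) ` \<rat>"
  proof safe
    fix z :: real assume "\<bar>z\<bar> < 2" and "arccos (z / 2) / (2 * pi) \<in> \<rat>"
    then show "z \<in> (\<lambda>q. 2 * cos (q * (2 * pi))) ` \<rat>"
      by (intro image_eqI[of _ _ "arccos (z / 2) / (2 * pi)"]) auto
  qed
qed (simp add: countable_rat)

section \<open>The zero-one law in the elliptic region\<close>

lemma null_sets_iff_negligible:
  fixes S :: "'a::euclidean_space set"
  assumes "S \<in> sets borel"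
  shows "S \<in> null_sets lborel \<longleftrightarrow> negligible S"
  using assms by (simp add: negligible_iff_null_sets null_sets_completion_iff)

lemma null_sets_imp_negligible: "S \<in> null_sets lborel \<Longrightarrow> negligible S"
  by (simp add: negligible_iff_null_sets null_sets_completionI)

lemma AE_lborel_obtain:
  assumes "AE x in lborel. R x"
  obtains N where "N \<in> null_sets lborel" "\<And>x. x \<notin> N \<Longrightarrow> R x"
proof -
  obtain N where "N \<in> null_sets lborel" "{x \<in> space lborel. \<not> R x} \<subseteq> N"
    using assms unfolding eventually_ae_filter by blast
  then show thesis using that[of N] by auto
qed

lemma param_dom_swap: "(w, z) \<in> param_dom c \<longleftrightarrow> (z, w) \<in> param_dom c"
  unfolding param_dom_iff using sq_sum_commute sq_diff_commute by metis

lemma param_dom_minus: "(- z, - w) \<in> param_dom c \<longleftrightarrow> (z, w) \<in> param_dom c"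
  unfolding param_dom_iff using sq_sum_minus sq_diff_minus by auto

lemma param_dom_antidiagonal:
  assumes "c < z\<^sup>2" "c < 4"
  shows "(z, - z) \<in> param_dom c"
  using assms by (simp add: param_dom_iff sq_sum_def sq_diff_def algebra_simps power2_eq_square)

text \<open>Almost every vertical slice of \<open>T\<close> is null or full, so membership of \<open>(z, w)\<close> in \<open>T\<close> is decided, up
  to a null set, by whether \<open>z\<close> lies in the set \<open>B\<close> of heights with null slice. Since \<open>T\<close> is symmetric
  under exchange, \<open>z \<in> B\<close> and \<open>w \<in> B\<close> agree for almost all \<open>(z, w)\<close> with both entries elliptic. The domain
  contains a neighbourhood of \<open>(z, - z)\<close>, and \<open>B\<close> is symmetric about 0, so \<open>B\<close> is locally null or conull, and by
  connectedness null or conull, on the positive elliptic heights \<open>{sqrt (max 0 c)<..<2}\<close>. The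
  sign change carries this over to the negative heights, which for \<open>c \<ge> 0\<close> form
  a separate component.\<close>

lemma zero_one_elliptic_region:
  fixes T :: "(real \<times> real) set"
  assumes c: "c < 4" and T: "T \<in> sets borel" and sub: "T \<subseteq> param_dom c"
    and swap: "\<And>z w. (z, w) \<in> T \<longleftrightarrow> (w, z) \<in> T"
    and minus: "\<And>z w. (z, w) \<in> T \<longleftrightarrow> (- z, - w) \<in> T"
    and slices: "AE z in lborel. \<bar>z\<bar> < 2 \<longrightarrow>
      negligible (Pair z -` T) \<or> negligible (Pair z -` (param_dom c - T))"
  shows "T \<inter> {q. \<bar>fst q\<bar> < 2} \<in> null_sets lborel \<or> (param_dom c - T) \<inter> {q. \<bar>fst q\<bar> < 2} \<in> null_sets lborel"
proof -
  have strip: "{q :: real \<times> real. \<bar>fst q\<bar> < 2} \<in> sets borel"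
    by (intro borel_open open_Collect_less continuous_intros)
  have dom: "param_dom c \<in> sets borel" using open_param_dom by simp
  have slice_sets: "Pair z -` K \<in> sets borel" if "K \<in> sets borel" for K :: "(real \<times> real) set" and z
    by (rule measurable_sets_borel[OF _ that])
      (intro borel_measurable_continuous_onI continuous_intros)
  define B where "B = {z. emeasure lborel (Pair z -` T) = 0}"
  have B_iff: "z \<in> B \<longleftrightarrow> negligible (Pair z -` T)" for z
    using null_sets_iff_negligible[OF slice_sets[OF T]] slice_sets[OF T] by (auto simp: B_def null_sets_def)
  have B: "B \<in> sets borel"
  proof -
    have "T \<in> sets (lborel \<Otimes>\<^sub>M lborel)" using T unfolding lborel_prod by simp
    then have "(\<lambda>z. emeasure lborel (Pair z -` T)) \<in> borel_measurable lborel"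
      by (rule lborel.measurable_emeasure_Pair)
    then show ?thesis unfolding B_def by measurable
  qed
  have B_minus: "- z \<in> B \<longleftrightarrow> z \<in> B" for z
  proof -
    have "Pair (- z) -` T = uminus -` (Pair z -` T)" using minus[of z "- w" for w] by auto
    moreover have "z \<in> B \<longleftrightarrow> Pair z -` T \<in> null_sets lborel" for z
      using slice_sets[OF T, of z] by (simp add: B_def null_sets_def)
    ultimately show ?thesis by (simp only: null_sets_uminus_iff)
  qed
  have fstB: "{q :: real \<times> real. fst q \<in> B} \<in> sets borel"
  proof -
    have "(fst :: real \<times> real \<Rightarrow> real) \<in> borel_measurable borel"
      by (intro borel_measurable_continuous_onI continuous_intros)
    from measurable_sets_borel[OF this B] show ?thesis by (simp add: vimage_def)
  qed
  \<comment> \<open>The pairs whose membership in \<open>T\<close> disagrees with the verdict of their slice.\<close>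
  define K where "K = {q. \<bar>fst q\<bar> < 2} \<inter> ((T \<inter> {q. fst q \<in> B}) \<union> ((param_dom c - T) - {q. fst q \<in> B}))"
  have K: "K \<in> sets borel" unfolding K_def using strip T dom fstB by auto
  have "AE z in lborel. Pair z -` K \<in> null_sets lborel"
    using slices
  proof eventually_elim
    case (elim z)
    show ?case
    proof (cases "\<bar>z\<bar> < 2")
      case True
      have "negligible (Pair z -` K)"
      proof (cases "z \<in> B")
        case True
        then have "negligible (Pair z -` T)" using B_iff by blast
        then show ?thesis by (rule negligible_subset) (use True in \<open>auto simp: K_def\<close>)
      next
        case False
        then have "negligible (Pair z -` (param_dom c - T))" using elim True B_iff by blast
        then show ?thesis by (rule negligible_subset) (use False in \<open>auto simp: K_def\<close>)
      qed
      then show ?thesis using null_sets_iff_negligible[OF slice_sets[OF K]] by blast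
    next
      case False
      then have "Pair z -` K = {}" by (auto simp: K_def)
      then show ?thesis by simp
    qed
  qed
  then have K_null: "K \<in> null_sets lborel" using null_sets_prod_iff[OF K] by blast
  have agree: "z \<in> B \<longleftrightarrow> w \<in> B"
    if "(z, w) \<in> param_dom c" "\<bar>z\<bar> < 2" "\<bar>w\<bar> < 2" "(z, w) \<notin> K" "(w, z) \<notin> K" for z w
    using that swap[of z w] param_dom_swap[of w z c] unfolding K_def by auto
  have K2: "K \<union> prod.swap -` K \<in> null_sets lborel"
    using K_null null_sets_swap[OF K_null] by (rule null_sets.Un)
  then have "AE z in lborel. Pair z -` (K \<union> prod.swap -` K) \<in> null_sets lborel"
    using null_sets_prod_iff[of "K \<union> prod.swap -` K"] by auto
  then obtain N where N: "N \<in> null_sets lborel" "\<And>z. z \<notin> N \<Longrightarrow> Pair z -` (K \<union> prod.swap -` K) \<in> null_sets lborel"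
    using AE_lborel_obtain by blast
  have N_neg: "negligible N" using N(1) by (rule null_sets_imp_negligible)
  define m where "m = sqrt (max 0 c)"
  have m: "0 \<le> m" by (simp add: m_def)
  have m_iff: "z \<in> {m<..<2} \<longleftrightarrow> 0 < z \<and> z < 2 \<and> c < z\<^sup>2" for z
  proof -
    have "m < z \<longleftrightarrow> 0 < z \<and> c < z\<^sup>2"
    proof (cases "0 < z")
      case True
      then have "m < z \<longleftrightarrow> max 0 c < z\<^sup>2" unfolding m_def
        using real_sqrt_less_iff[of "max 0 c" "z\<^sup>2"] by simp
      then show ?thesis using True by auto
    qed (use m in auto)
    then show ?thesis by auto
  qed
  have "negligible ({m<..<2} \<inter> B) \<or> negligible ({m<..<2} - B)"
  proof (rule locally_null_connected[OF _ _ B])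
    fix z0 assume z0: "z0 \<in> {m<..<2}"
    define W where "W = param_dom c \<inter> ({m<..<2} \<times> {-2<..<2})"
    have "open W" unfolding W_def by (intro open_Int open_param_dom open_Times open_greaterThanLessThan)
    moreover have "(z0, - z0) \<in> W" using z0 param_dom_antidiagonal[of c z0] c m_iff[of z0] by (simp add: W_def)
    ultimately obtain U V where UV: "open U" "open V" "z0 \<in> U" "- z0 \<in> V" "U \<times> V \<subseteq> W"
      by (rule open_prod_elim) auto
    obtain d where d: "d > 0" "ball z0 d \<subseteq> U" using UV open_contains_ball by blast
    obtain e where e: "e > 0" "ball (- z0) e \<subseteq> V" using UV open_contains_ball by blast
    define r where "r = min d e"
    have r: "r > 0" "ball z0 r \<subseteq> U" "ball (- z0) r \<subseteq> V" using d e by (auto simp: r_def)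
    \<comment> \<open>A single good height \<open>z\<close> near \<open>z0\<close> decides almost all heights near \<open>z0\<close>.\<close>
    have "\<not> ball z0 r \<subseteq> N"
    proof
      assume "ball z0 r \<subseteq> N"
      then have "negligible (ball z0 r)" using N_neg negligible_subset by blast
      then show False using open_not_negligible[of "ball z0 r"] r(1) by simp
    qed
    then obtain z where z: "z \<in> ball z0 r" "z \<notin> N" by blast
    then have "Pair z -` (K \<union> prod.swap -` K) \<in> null_sets lborel" using N(2) by blast
    then have "uminus -` (Pair z -` (K \<union> prod.swap -` K)) \<in> null_sets lborel" by (simp only: null_sets_uminus_iff)
    then have neg: "negligible (uminus -` (Pair z -` (K \<union> prod.swap -` K)))"
      by (rule null_sets_imp_negligible)
    have "z \<in> B \<longleftrightarrow> w \<in> B" if "w \<in> ball z0 r" "w \<notin> uminus -` (Pair z -` (K \<union> prod.swap -` K))" for w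
    proof -
      have "- w \<in> ball (- z0) r" using that(1) by (simp add: dist_real_def abs_minus_commute)
      then have "(z, - w) \<in> W" using r z UV by blast
      then have "z \<in> B \<longleftrightarrow> - w \<in> B" using agree[of z "- w"] that(2) m by (auto simp: W_def)
      then show ?thesis using B_minus by simp
    qed
    note same = this
    have "negligible (ball z0 r \<inter> B) \<or> negligible (ball z0 r - B)"
    proof (cases "z \<in> B")
      case True
      have "negligible (ball z0 r - B)" by (rule negligible_subset[OF neg]) (use True same in blast)
      then show ?thesis ..
    next
      case False
      have "negligible (ball z0 r \<inter> B)" by (rule negligible_subset[OF neg]) (use False same in blast)
      then show ?thesis ..
    qed
    moreover have "ball z0 r \<subseteq> {m<..<2}" using r(2) UV unfolding W_def by blast
    ultimately show "\<exists>e>0. ball z0 e \<subseteq> {m<..<2} \<and> (negligible (ball z0 e \<inter> B) \<or> negligible (ball z0 e - B))"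
      using r(1) by blast
  qed auto
  then have dich: "{m<..<2} \<inter> B \<in> null_sets lborel \<or> {m<..<2} - B \<in> null_sets lborel"
    using B null_sets_iff_negligible[of "{m<..<2} \<inter> B"] null_sets_iff_negligible[of "{m<..<2} - B"] by auto
  have fill: "K' \<in> null_sets lborel"
    if K': "K' \<in> sets borel" "K' \<subseteq> param_dom c \<inter> {q. \<bar>fst q\<bar> < 2}"
      and J: "J \<in> null_sets lborel"
      and sl: "\<And>z. z \<in> {m<..<2} - J \<Longrightarrow> negligible (Pair z -` K') \<and> negligible (Pair (- z) -` K')" for K' J
  proof -
    have "AE z in lborel. Pair z -` K' \<in> null_sets lborel"
      using AE_not_in[OF J] AE_not_in[OF null_sets_uminus_iff[THEN iffD2, OF J]] AE_lborel_singleton[of 0]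
    proof eventually_elim
      case (elim z)
      have "negligible (Pair z -` K')"
      proof (cases "Pair z -` K' = {}")
        case False
        then obtain w where "(z, w) \<in> K'" by auto
        then have "(z, w) \<in> param_dom c" "\<bar>z\<bar> < 2" using K'(2) by auto
        then have "\<bar>z\<bar> \<in> {m<..<2}" using elim param_dom_elliptic[of z w c] m_iff[of "\<bar>z\<bar>"] by simp
        then show ?thesis using sl[of "\<bar>z\<bar>"] elim by (cases "0 \<le> z") auto
      qed simp
      then show ?case using null_sets_iff_negligible[OF slice_sets[OF K'(1)]] by blast
    qed
    then show ?thesis using null_sets_prod_iff[OF K'(1)] by blast
  qed
  from dich show ?thesis
  proof
    assume conull: "{m<..<2} - B \<in> null_sets lborel"
    have "T \<inter> {q. \<bar>fst q\<bar> < 2} \<in> null_sets lborel"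
    proof (rule fill[OF _ _ conull])
      fix z assume "z \<in> {m<..<2} - ({m<..<2} - B)"
      then have "negligible (Pair z -` T)" "negligible (Pair (- z) -` T)" using B_iff B_minus by auto
      then show "negligible (Pair z -` (T \<inter> {q. \<bar>fst q\<bar> < 2})) \<and> negligible (Pair (- z) -` (T \<inter> {q. \<bar>fst q\<bar> < 2}))"
        by (auto elim!: negligible_subset)
    qed (use T strip sub in auto)
    then show ?thesis ..
  next
    assume null: "{m<..<2} \<inter> B \<in> null_sets lborel"
    obtain X where X: "X \<in> null_sets lborel" and X': "\<And>z. z \<notin> X \<Longrightarrow> \<bar>z\<bar> < 2 \<longrightarrow>
        negligible (Pair z -` T) \<or> negligible (Pair z -` (param_dom c - T))"
      using AE_lborel_obtain[OF slices] by blast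
    have J: "({m<..<2} \<inter> B) \<union> (X \<union> uminus -` X) \<in> null_sets lborel"
      using null X null_sets_uminus_iff[THEN iffD2, OF X] by (intro null_sets.Un)
    have "(param_dom c - T) \<inter> {q. \<bar>fst q\<bar> < 2} \<in> null_sets lborel"
    proof (rule fill[OF _ _ J])
      fix z assume z: "z \<in> {m<..<2} - (({m<..<2} \<inter> B) \<union> (X \<union> uminus -` X))"
      then have "\<bar>z\<bar> < 2" "z \<notin> B" "- z \<notin> B" "z \<notin> X" "- z \<notin> X" using m B_minus by auto
      then have "negligible (Pair z -` (param_dom c - T))" "negligible (Pair (- z) -` (param_dom c - T))"
        using X'[of z] X'[of "- z"] B_iff by auto
      then show "negligible (Pair z -` ((param_dom c - T) \<inter> {q. \<bar>fst q\<bar> < 2})) \<and>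
        negligible (Pair (- z) -` ((param_dom c - T) \<inter> {q. \<bar>fst q\<bar> < 2}))"
        by (auto elim!: negligible_subset)
    qed (use T dom strip in auto)
    then show ?thesis ..
  qed
qed

section \<open>Words in the generators and their charts\<close>

text \<open>The generators are involutions, so these maps already form a group; being countable, it allows a union over
  all translates of a null set, and its elements can be handled by induction.\<close>

inductive_set words :: "(real^3 \<Rightarrow> real^3) set" where
  words_id: "id \<in> words"
| words_comp: "h \<in> words \<Longrightarrow> g \<in> Gamma_generators \<Longrightarrow> g \<circ> h \<in> words"

lemma countable_words: "countable words"
proof (rule countable_subset)
  show "words \<subseteq> (\<lambda>gs. foldr (\<circ>) gs id) ` lists Gamma_generators"
  proof
    fix h assume "h \<in> words"
    then show "h \<in> (\<lambda>gs. foldr (\<circ>) gs id) ` lists Gamma_generators"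
    proof induction
      case words_id
      show ?case by (rule image_eqI[of _ _ "[]"]) auto
    next
      case (words_comp h g)
      then obtain gs where gs: "h = foldr (\<circ>) gs id" "gs \<in> lists Gamma_generators" by blast
      then have "g \<circ> h = foldr (\<circ>) (g # gs) id" by simp
      then show ?case by (rule image_eqI) (use gs words_comp in simp)
    qed
  qed
  show "countable ((\<lambda>gs. foldr (\<circ>) gs id) ` lists Gamma_generators)"
    unfolding Gamma_generators_def by (intro countable_image countable_lists countable_finite) simp
qed

lemma generators_in_words: "g \<in> Gamma_generators \<Longrightarrow> g \<in> words"
  using words_comp[OF words_id] by simp

lemma words_compose: "h1 \<in> words \<Longrightarrow> h2 \<in> words \<Longrightarrow> h1 \<circ> h2 \<in> words"
  by (induction rule: words.induct) (auto simp: comp_assoc intro: words_comp)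

lemma words_inverse: "h \<in> words \<Longrightarrow> \<exists>h'\<in>words. \<forall>p. h' (h p) = p"
proof (induction rule: words.induct)
  case words_id
  show ?case by (intro bexI[of _ id] words.words_id) simp
next
  case (words_comp h g)
  then obtain h' where "h' \<in> words" "\<forall>p. h' (h p) = p" by blast
  then show ?case
    using words_comp words_compose[OF _ generators_in_words, of h' g] Gamma_generators_involutive[of g]
    by (intro bexI[of _ "h' \<circ> g"]) auto
qed

lemma generators_in_Gamma_group: "g \<in> Gamma_generators \<Longrightarrow> g \<in> Gamma_group"
  unfolding Gamma_group_def by (rule generate.incl)

lemma words_invariant:
  assumes inv: "\<And>g p. g \<in> Gamma_generators \<Longrightarrow> g p \<in> A \<longleftrightarrow> p \<in> A" and "h \<in> words"
  shows "h p \<in> A \<longleftrightarrow> p \<in> A"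
  using \<open>h \<in> words\<close> by (induction rule: words.induct) (auto simp: inv)

lemma words_level: "h \<in> words \<Longrightarrow> h p \<in> level k \<longleftrightarrow> p \<in> level k"
  by (rule words_invariant) (auto simp: level_def Gamma_generators_preserve_kappa)

lemma has_derivative_vector_3:
  assumes "(f1 has_derivative f1') F" "(f2 has_derivative f2') F" "(f3 has_derivative f3') F"
  shows "((\<lambda>x. vector [f1 x, f2 x, f3 x] :: real^3) has_derivative
    (\<lambda>h. vector [f1' h, f2' h, f3' h])) F"
proof -
  have v: "vector [a, b, c] = a *\<^sub>R axis 1 1 + b *\<^sub>R axis 2 1 + (c *\<^sub>R axis 3 1 :: real^3)" for a b c :: real
    by (simp add: vec_eq_iff forall_3 axis_def)
  show ?thesis unfolding v
    by (intro has_derivative_add has_derivative_scaleR_left assms)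
qed

lemma continuous_on_vector_3:
  assumes "continuous_on A f1" "continuous_on A f2" "continuous_on A f3"
  shows "continuous_on A (\<lambda>x. vector [f1 x, f2 x, f3 x] :: real^3)"
proof -
  have "continuous_on A (\<lambda>x. (vector [f1 x, f2 x, f3 x] :: real^3) $ i)" for i
    using exhaust_3[of i] assms by auto
  then have "continuous_on A (\<lambda>x. \<chi> i. (vector [f1 x, f2 x, f3 x] :: real^3) $ i)" by (rule continuous_on_vec_lambda)
  then show ?thesis by simp
qed

lemma generator_derivative:
  assumes "g \<in> Gamma_generators"
  shows "\<exists>G. (\<forall>p. (g has_derivative G p) (at p)) \<and> continuous_on UNIV (\<lambda>(p, h). G p h)"
proof -
  have nth: "((\<lambda>v::real^3. v $ i) has_derivative (\<lambda>h. h $ i)) (at p)" for i p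
    by (rule bounded_linear_imp_has_derivative[OF bounded_linear_vec_nth])
  note d = derivative_eq_intros has_derivative_vector_3 nth
  note [continuous_intros] = continuous_on_vector_3
  have 1: ?thesis if "g = (\<lambda>p. vector [p$2 * p$3 - p$1, p$2, p$3])"
    unfolding that case_prod_beta
    by (rule exI[of _ "\<lambda>p h. vector [p$2 * h$3 + h$2 * p$3 - h$1, h$2, h$3]"])
      (auto intro!: d continuous_intros)
  have 2: ?thesis if "g = (\<lambda>p. vector [p$1, p$1 * p$3 - p$2, p$3])"
    unfolding that case_prod_beta
    by (rule exI[of _ "\<lambda>p h. vector [h$1, p$1 * h$3 + h$1 * p$3 - h$2, h$3]"])
      (auto intro!: d continuous_intros)
  have 3: ?thesis if "g = (\<lambda>p. vector [p$1, p$2, - p$1 * p$2 - p$3])"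
    unfolding that case_prod_beta
    by (rule exI[of _ "\<lambda>p h. vector [h$1, h$2, - p$1 * h$2 + (- h$1) * p$2 - h$3]"])
      (auto intro!: d continuous_intros)
  have 4: ?thesis if "g = (\<lambda>p. vector [a * p$i, b * p$j, e * p$3])" for a b e i j
    unfolding that case_prod_beta
    by (rule exI[of _ "\<lambda>p h. vector [a * h$i, b * h$j, e * h$3]"])
      (auto intro!: d continuous_intros)
  show ?thesis
    using assms 1 2 3 4[of 1 1 "-1" 2 "-1"] 4[of "-1" 1 1 2 "-1"] 4[of "-1" 1 "-1" 2 1] 4[of 1 2 1 1 1]
    unfolding Gamma_generators_def by auto
qed

text \<open>Composing a chart with a generator gives a chart again, so the area measure can be computed in
  translates of one chart, with the same parameter set. Differentiating \<open>g (g p) = p\<close> shows that the derivative of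
  a generator is injective.\<close>

lemma chart_generator:
  assumes chart: "chart_of_level k U \<phi> D" and g: "g \<in> Gamma_generators"
  shows "\<exists>D'. chart_of_level k U (g \<circ> \<phi>) D'"
proof -
  obtain G where G: "\<And>p. (g has_derivative G p) (at p)" "continuous_on UNIV (\<lambda>(p, h). G p h)"
    using generator_derivative[OF g] by blast
  have injG: "inj (G p)" for p
  proof -
    have "((\<lambda>x. g (g x)) has_derivative (\<lambda>h. G (g p) (G p h))) (at p)"
      by (rule has_derivative_compose[OF G(1) G(1)])
    then have "((\<lambda>x. x) has_derivative (\<lambda>h. G (g p) (G p h))) (at p)"
      by (simp add: Gamma_generators_involutive[OF g])
    then have "(\<lambda>h. G (g p) (G p h)) = (\<lambda>h. h)"
      using has_derivative_unique has_derivative_ident by blast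
    then show ?thesis by (metis injI)
  qed
  have "inj g" using Gamma_generators_involutive[OF g] by (metis injI)
  have "g 0 = 0" using g unfolding Gamma_generators_def by (auto simp: vec_eq_iff forall_3)
  then have smooth: "g p \<in> smooth_part k" if "p \<in> smooth_part k" for p
  proof -
    have "g p \<noteq> 0" using that \<open>g 0 = 0\<close> Gamma_generators_involutive[OF g, of p] by (auto simp: smooth_part_eq)
    then show ?thesis using that Gamma_generators_preserve_kappa[OF g] by (auto simp: smooth_part_eq level_def)
  qed
  have c: "open U" "inj_on \<phi> U" "\<phi> ` U \<subseteq> smooth_part k"
    "\<And>q. q \<in> U \<Longrightarrow> (\<phi> has_derivative D q) (at q)" "\<And>q. q \<in> U \<Longrightarrow> inj (D q)"
    "\<And>h. continuous_on U (\<lambda>q. D q h)"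
    using chart unfolding chart_of_level_def by auto
  have "continuous_on U \<phi>"
    using c(4) by (meson continuous_at_imp_continuous_on has_derivative_continuous)
  then have "continuous_on U (\<lambda>q. G (\<phi> q) (D q h))" for h
    using continuous_on_compose2[OF G(2) continuous_on_Pair[OF _ c(6)[of h]], of \<phi>] by simp
  moreover have "(g \<circ> \<phi> has_derivative (\<lambda>h. G (\<phi> q) (D q h))) (at q)" if "q \<in> U" for q
    using has_derivative_compose[OF c(4)[OF that] G(1)] by (simp add: o_def)
  moreover have "inj (\<lambda>h. G (\<phi> q) (D q h))" if "q \<in> U" for q
    using inj_compose[OF injG c(5)[OF that]] by (simp add: o_def)
  moreover have "inj_on (g \<circ> \<phi>) U" using c(2) \<open>inj g\<close> by (meson comp_inj_on inj_on_subset subset_UNIV)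
  ultimately have "chart_of_level k U (g \<circ> \<phi>) (\<lambda>q h. G (\<phi> q) (D q h))"
    unfolding chart_of_level_def using c(1,3) smooth by auto
  then show ?thesis by blast
qed

lemma chart_words: "h \<in> words \<Longrightarrow> chart_of_level k U \<phi> D \<Longrightarrow> \<exists>D'. chart_of_level k U (h \<circ> \<phi>) D'"
proof (induction rule: words.induct)
  case (words_comp h g)
  then show ?case using chart_generator[of k U "h \<circ> \<phi>" _ g] by (metis comp_assoc)
qed auto

section \<open>Null sets of the area measure\<close>

lemma level_iff: "p \<in> level k \<longleftrightarrow> (p$1)\<^sup>2 + (p$2)\<^sup>2 - p$1 * p$2 * p$3 = (p$3)\<^sup>2 - (k + 2)"
  by (auto simp: level_def kappa_Phi_def algebra_simps)

lemma param_onto: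
  assumes "p \<in> level k" "\<bar>p$2\<bar> < p$1"
  shows "(p$3, - p$1 * p$2 - p$3) \<in> param_dom (k + 2)"
    and "param (k + 2) (p$3, - p$1 * p$2 - p$3) = p"
proof -
  let ?x = "p$1" and ?y = "p$2" and ?z = "p$3"
  have l: "?x\<^sup>2 + ?y\<^sup>2 - ?x * ?y * ?z = ?z\<^sup>2 - (k + 2)" using assms(1) by (simp add: level_iff)
  have PQ: "sq_sum (k + 2) ?z (- ?x * ?y - ?z) = (?x + ?y)\<^sup>2" "sq_diff (k + 2) ?z (- ?x * ?y - ?z) = (?x - ?y)\<^sup>2"
    using l unfolding sq_sum_def sq_diff_def by (simp_all add: algebra_simps power2_eq_square)
  have pos: "0 < ?x + ?y" "0 < ?x - ?y" using assms(2) by auto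
  show "(?z, - ?x * ?y - ?z) \<in> param_dom (k + 2)" using pos unfolding param_dom_iff PQ by simp
  show "param (k + 2) (?z, - ?x * ?y - ?z) = p"
    using pos unfolding vec_eq_iff forall_3 param_nth PQ by simp
qed

lemma param_in_level: "q \<in> param_dom (k + 2) \<Longrightarrow> param (k + 2) q \<in> level k"
  using param_level[of "fst q" "snd q" "k + 2"] by (cases q) (simp add: level_iff del: param_nth(1,2))

lemma param_quadrant: "(z, w) \<in> param_dom c \<Longrightarrow> \<bar>param c (z, w) $ 2\<bar> < param c (z, w) $ 1"
  by (auto simp: param_dom_iff abs_less_iff)

lemma inj_on_param: "inj_on (param c) (param_dom c)"
proof (rule inj_onI, safe)
  fix z w z' w' assume "(z, w) \<in> param_dom c" "(z', w') \<in> param_dom c" "param c (z, w) = param c (z', w')"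
  then show "z = z'" "w = w'"
    using param_vieta[of z w c] param_vieta[of z' w' c] param_nth(3)[of c z w] param_nth(3)[of c z' w'] by metis+
qed

lemma has_derivative_sqrt:
  assumes "(f has_derivative f') (at x)" "f x > 0"
  shows "((\<lambda>x. sqrt (f x)) has_derivative (\<lambda>h. f' h / (2 * sqrt (f x)))) (at x)"
proof -
  have "(sqrt has_derivative (*) (inverse (sqrt (f x)) / 2)) (at (f x))"
    using DERIV_real_sqrt[OF assms(2)] unfolding has_field_derivative_def .
  from has_derivative_compose[OF assms(1) this] show ?thesis by (simp add: field_simps)
qed

lemma chart_param: "\<exists>D. chart_of_level k (param_dom (k + 2)) (param (k + 2)) D"
proof -
  define c where "c = k + 2"
  define D1 D2 where "D1 = (\<lambda>(z, w) (h :: real \<times> real). (- ((w + 2) * fst h + (z + 2) * snd h)) / (2 * sqrt (sq_sum c z w)))"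
    and "D2 = (\<lambda>(z, w) (h :: real \<times> real). (- ((w - 2) * fst h + (z - 2) * snd h)) / (2 * sqrt (sq_diff c z w)))"
  define D where "D q h = (vector [(D1 q h + D2 q h) / 2, (D1 q h - D2 q h) / 2, fst h] :: real^3)" for q h
  have der: "(param c has_derivative D q) (at q)" if q: "q \<in> param_dom c" for q
  proof -
    obtain z w where zw: "q = (z, w)" by (cases q)
    have pos: "sq_sum c z w > 0" "sq_diff c z w > 0" using q by (simp_all add: zw param_dom_iff)
    have "((\<lambda>q. sq_sum c (fst q) (snd q)) has_derivative (\<lambda>h. - ((w + 2) * fst h + (z + 2) * snd h))) (at q)"
      unfolding sq_sum_def zw by (auto intro!: derivative_eq_intros simp: algebra_simps)
    from has_derivative_sqrt[OF this]
    have "((\<lambda>q. sqrt (sq_sum c (fst q) (snd q))) has_derivative D1 q) (at q)"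
      using pos by (simp add: zw D1_def)
    moreover have "((\<lambda>q. sq_diff c (fst q) (snd q)) has_derivative (\<lambda>h. - ((w - 2) * fst h + (z - 2) * snd h))) (at q)"
      unfolding sq_diff_def zw by (auto intro!: derivative_eq_intros simp: algebra_simps)
    from has_derivative_sqrt[OF this]
    have "((\<lambda>q. sqrt (sq_diff c (fst q) (snd q))) has_derivative D2 q) (at q)"
      using pos by (simp add: zw D2_def)
    ultimately show ?thesis
      unfolding param_def D_def case_prod_beta
      by (intro has_derivative_vector_3 bounded_linear.has_derivative[OF bounded_linear_divide]
          has_derivative_add has_derivative_diff has_derivative_fst has_derivative_ident)
  qed
  have "inj (D q)" if q: "q \<in> param_dom c" for q
  proof -
    obtain z w where zw: "q = (z, w)" by (cases q)
    have pos: "sq_sum c z w > 0" "sq_diff c z w > 0" using q by (simp_all add: zw param_dom_iff)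
    have "linear (D q)" using der[OF q] has_derivative_linear by blast
    moreover have "h = 0" if "D q h = 0" for h
    proof -
      have e: "fst h = 0" "D1 q h + D2 q h = 0" "D1 q h - D2 q h = 0"
        using that unfolding D_def by (simp_all add: vec_eq_iff forall_3)
      then have "(z + 2) * snd h = 0" "(z - 2) * snd h = 0"
        using pos by (auto simp: D1_def D2_def zw)
      then have "snd h = 0" by auto
      then show ?thesis using e by (simp add: prod_eq_iff)
    qed
    ultimately show ?thesis by (simp add: linear_injective_0)
  qed
  moreover have "continuous_on (param_dom c) (\<lambda>q. D q h)" for h
  proof -
    have "continuous_on (param_dom c) (\<lambda>q. D1 q h)" "continuous_on (param_dom c) (\<lambda>q. D2 q h)"
      unfolding D1_def D2_def case_prod_beta sq_sum_def sq_diff_def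
      by (intro continuous_intros; force simp: param_dom_def sq_sum_def sq_diff_def)+
    then show ?thesis unfolding D_def by (intro continuous_on_vector_3 continuous_intros) simp_all
  qed
  moreover have "param c q \<in> smooth_part k" if "q \<in> param_dom c" for q
  proof -
    have "\<bar>param c q $ 2\<bar> < param c q $ 1" using param_quadrant[of "fst q" "snd q" c] that by simp
    then have "param c q \<noteq> 0" by auto
    then show ?thesis using param_in_level[of q k] that by (simp add: smooth_part_eq c_def)
  qed
  ultimately show ?thesis
    unfolding chart_of_level_def c_def[symmetric] using open_param_dom inj_on_param der
    by (intro exI[of _ D]) blast
qed

lemma level_borel: "level k \<in> sets borel"
proof -
  have "continuous_on UNIV kappa_Phi"
    using kappa_Phi_has_derivative by (meson continuous_at_imp_continuous_on has_derivative_continuous)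
  then have "kappa_Phi \<in> borel_measurable borel" by (rule borel_measurable_continuous_onI)
  then show ?thesis unfolding level_def by (rule measurable_sets_borel) simp
qed

lemma sets_area_measure: "is_area_measure k M \<Longrightarrow> A \<in> sets M \<longleftrightarrow> A \<subseteq> level k \<and> A \<in> sets borel"
  unfolding is_area_measure_def using level_borel[of k] by (auto simp: sets_restrict_space_iff)

lemma space_area_measure: "is_area_measure k M \<Longrightarrow> space M = level k"
proof -
  assume "is_area_measure k M"
  then have "space M = space (restrict_space borel (level k))"
    by (intro sets_eq_imp_space_eq) (simp add: is_area_measure_def)
  then show ?thesis by (simp add: space_restrict_space)
qed

text \<open>The area measure is absolutely continuous in every chart: whatever the density, its integral over a Lebesgue
  null set of parameters vanishes.\<close>

lemma chart_null:
  assumes M: "is_area_measure k M" and chart: "chart_of_level k U \<phi> D"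
    and N: "N \<in> null_sets lborel" "N \<subseteq> U" and img: "\<phi> ` N \<in> sets borel"
  shows "\<phi> ` N \<in> null_sets M"
proof (rule null_setsI)
  have c: "\<phi> ` U \<subseteq> level k" "inj_on \<phi> U" using chart by (auto simp: chart_of_level_def smooth_part_eq)
  then show s: "\<phi> ` N \<in> sets M" using sets_area_measure[OF M] N(2) img by auto
  have eq: "{q \<in> U. \<phi> q \<in> \<phi> ` N} = N"
  proof (intro equalityI subsetI)
    fix q assume "q \<in> {q \<in> U. \<phi> q \<in> \<phi> ` N}"
    then obtain r where "q \<in> U" "r \<in> N" "\<phi> q = \<phi> r" by blast
    then show "q \<in> N" using c(2) N(2) by (metis inj_onD subsetD)
  qed (use N(2) in blast)
  have "emeasure M A = (\<integral>\<^sup>+q\<in>{q \<in> U. \<phi> q \<in> A}. ennreal \<bar>area_form (\<phi> q) (D q (1, 0)) (D q (0, 1))\<bar> \<partial>lborel)"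
    if "A \<in> sets M" "A \<subseteq> \<phi> ` U" for A
    using M chart that unfolding is_area_measure_def by blast
  from this[OF s image_mono[OF N(2)]]
  have "emeasure M (\<phi> ` N) = (\<integral>\<^sup>+q\<in>N. ennreal \<bar>area_form (\<phi> q) (D q (1, 0)) (D q (0, 1))\<bar> \<partial>lborel)"
    unfolding eq .
  then show "emeasure M (\<phi> ` N) = 0" using nn_integral_null_set[OF N(1)] by simp
qed

lemma words_image_borel:
  assumes "h \<in> words"
  shows "X \<in> sets borel \<Longrightarrow> h ` X \<in> sets borel"
  using assms
proof (induction arbitrary: X rule: words.induct)
  case (words_comp h g)
  obtain G where "\<And>p. (g has_derivative G p) (at p)" using generator_derivative[OF words_comp(2)] by blast
  then have "continuous_on UNIV g" by (meson continuous_at_imp_continuous_on has_derivative_continuous)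
  then have m: "g \<in> borel_measurable borel" by (rule borel_measurable_continuous_onI)
  have "(g \<circ> h) ` X = g -` (h ` X)"
  proof (intro equalityI subsetI)
    fix p assume "p \<in> g -` (h ` X)"
    then obtain q where q: "q \<in> X" "g p = h q" by auto
    then have "p = (g \<circ> h) q" using Gamma_generators_involutive[OF words_comp(2), of p] by simp
    then show "p \<in> (g \<circ> h) ` X" using q(1) by (rule image_eqI)
  qed (use Gamma_generators_involutive[OF words_comp(2)] in auto)
  then show ?case using measurable_sets_borel[OF m words_comp(3)[OF words_comp(4)]] by simp
qed simp

lemma param_image_borel:
  assumes N: "N \<in> sets borel" "N \<subseteq> param_dom (k + 2)"
  shows "param (k + 2) ` N \<in> sets borel"
proof -
  define \<pi> where "\<pi> p = (p$3, - p$1 * p$2 - p$3)" for p :: "real^3"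
  have "continuous_on UNIV \<pi>" unfolding \<pi>_def by (intro continuous_intros)
  then have "\<pi> \<in> borel_measurable borel" by (rule borel_measurable_continuous_onI)
  then have "\<pi> -` N \<in> sets borel" using N(1) by (rule measurable_sets_borel)
  moreover have "open {p :: real^3. \<bar>p$2\<bar> < p$1}" by (intro open_Collect_less continuous_intros)
  moreover have "param (k + 2) ` N = level k \<inter> {p. \<bar>p$2\<bar> < p$1} \<inter> \<pi> -` N"
  proof (intro equalityI subsetI)
    fix p assume "p \<in> level k \<inter> {p. \<bar>p$2\<bar> < p$1} \<inter> \<pi> -` N"
    then show "p \<in> param (k + 2) ` N"
      using param_onto(2)[of p k] by (intro image_eqI[of _ _ "\<pi> p"]) (auto simp: \<pi>_def)
  next
    fix p assume "p \<in> param (k + 2) ` N"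
    then obtain z w where zw: "(z, w) \<in> N" "p = param (k + 2) (z, w)" by auto
    then have d: "(z, w) \<in> param_dom (k + 2)" using N by blast
    then have "\<pi> p = (z, w)" unfolding \<pi>_def zw(2) using param_vieta[OF d] by (simp del: param_nth(1,2))
    then show "p \<in> level k \<inter> {p. \<bar>p$2\<bar> < p$1} \<inter> \<pi> -` N"
      using zw param_in_level[OF d] param_quadrant[OF d] by auto
  qed
  ultimately show ?thesis using level_borel[of k] by simp
qed

lemma words_param_null:
  assumes M: "is_area_measure k M" and N: "N \<in> null_sets lborel" "N \<subseteq> param_dom (k + 2)" and h: "h \<in> words"
  shows "h ` param (k + 2) ` N \<in> null_sets M"
proof -
  obtain D where chart: "chart_of_level k (param_dom (k + 2)) (h \<circ> param (k + 2)) D"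
    using chart_param chart_words[OF h] by blast
  have "(h \<circ> param (k + 2)) ` N \<in> sets borel"
    using words_image_borel[OF h param_image_borel[of N k]] N by (simp add: image_comp null_sets_def)
  from chart_null[OF M chart N this] show ?thesis by (simp only: image_comp)
qed

text \<open>The points with \<open>x = y = 0\<close> lie in no translate of the quarter \<open>\<bar>y\<bar> < x\<close>, because the group
  preserves this axis. For \<open>c = 0\<close> the only such point is the singular one; for \<open>c > 0\<close> there are two, and
  the surface is the union of two graphs over the plane \<open>(x, y)\<close>, which provide charts around them.\<close>

lemma axis_null:
  assumes M: "is_area_measure k M"
  shows "{p \<in> level k. p$1 = 0 \<and> p$2 = 0} \<in> null_sets M"
proof -
  define c where "c = k + 2"
  have axis: "{p \<in> level k. p$1 = 0 \<and> p$2 = 0} = {p. p$1 = 0 \<and> p$2 = 0 \<and> (p$3)\<^sup>2 = c}"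
  proof (rule Collect_cong)
    fix p :: "real^3"
    have "p \<in> level k \<longleftrightarrow> (p$3)\<^sup>2 = c" if "p$1 = 0" "p$2 = 0"
    proof -
      have "p \<in> level k \<longleftrightarrow> 0 = (p$3)\<^sup>2 - c" using level_iff[of p k] that by (simp add: c_def)
      then show ?thesis by linarith
    qed
    then show "p \<in> level k \<and> p$1 = 0 \<and> p$2 = 0 \<longleftrightarrow> p$1 = 0 \<and> p$2 = 0 \<and> (p$3)\<^sup>2 = c" by blast
  qed
  consider "c < 0" | "c = 0" | "c > 0" by linarith
  then show ?thesis
  proof cases
    case 1
    then have "x\<^sup>2 \<noteq> c" for x using zero_le_power2[of x] by linarith
    then have "{p \<in> level k. p$1 = 0 \<and> p$2 = 0} = {}" unfolding axis by auto
    then show ?thesis using null_sets.empty_sets[of M] by metis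
  next
    case 2
    then have "{p \<in> level k. p$1 = 0 \<and> p$2 = 0} = {0}" unfolding axis by (auto simp: vec_eq_iff forall_3)
    moreover have "level k - smooth_part k = {0}" using 2 by (auto simp: smooth_part_eq level_iff c_def)
    ultimately show ?thesis using M sets_area_measure[OF M, of "{0}"] unfolding is_area_measure_def
      by (auto simp: null_sets_def)
  next
    case 3
    \<comment> \<open>The discriminant of the level equation, read as a quadratic equation for \<open>z\<close>.\<close>
    define R where "R a b = (a * b)\<^sup>2 + 4 * (a\<^sup>2 + b\<^sup>2 + c)" for a b :: real
    have R: "R a b > 0" for a b unfolding R_def using 3 by (intro add_nonneg_pos) (auto intro: add_nonneg_pos)
    define \<phi> where "\<phi> q = (vector [fst q, snd q, (- (fst q * snd q) + sqrt (R (fst q) (snd q))) / 2] :: real^3)" for q :: "real \<times> real"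
    define E where "E q h = (- (fst q * snd h + fst h * snd q) +
      (2 * (fst q * snd q) * (fst q * snd h + fst h * snd q) + 8 * fst q * fst h + 8 * snd q * snd h)
        / (2 * sqrt (R (fst q) (snd q)))) / 2" for q h :: "real \<times> real"
    define D where "D q h = (vector [fst h, snd h, E q h] :: real^3)" for q h :: "real \<times> real"
    have "(\<phi> has_derivative D q) (at q)" for q
    proof -
      have "((\<lambda>q. R (fst q) (snd q)) has_derivative (\<lambda>h. 2 * (fst q * snd q) * (fst q * snd h + fst h * snd q)
          + 8 * fst q * fst h + 8 * snd q * snd h)) (at q)"
        unfolding R_def by (auto intro!: derivative_eq_intros simp: algebra_simps power2_eq_square)
      from has_derivative_sqrt[OF this R]
      have "((\<lambda>q. sqrt (R (fst q) (snd q))) has_derivative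
        (\<lambda>h. (2 * (fst q * snd q) * (fst q * snd h + fst h * snd q) + 8 * fst q * fst h + 8 * snd q * snd h)
          / (2 * sqrt (R (fst q) (snd q))))) (at q)" .
      moreover have "((\<lambda>q. - (fst q * snd q)) has_derivative (\<lambda>h. - (fst q * snd h + fst h * snd q))) (at q)"
        by (auto intro!: derivative_eq_intros)
      ultimately show ?thesis unfolding \<phi>_def D_def E_def
        by (intro has_derivative_vector_3 bounded_linear.has_derivative[OF bounded_linear_divide]
            has_derivative_add has_derivative_fst has_derivative_snd has_derivative_ident)
    qed
    moreover have "inj (D q)" for q
    proof (rule injI)
      fix h h' assume e: "D q h = D q h'"
      then have "D q h $ 1 = D q h' $ 1" "D q h $ 2 = D q h' $ 2" by auto
      then show "h = h'" by (simp add: D_def prod_eq_iff)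
    qed
    moreover have "inj \<phi>"
    proof (rule injI)
      fix q q' assume e: "\<phi> q = \<phi> q'"
      then have "\<phi> q $ 1 = \<phi> q' $ 1" "\<phi> q $ 2 = \<phi> q' $ 2" by auto
      then show "q = q'" by (simp add: \<phi>_def prod_eq_iff)
    qed
    moreover have "continuous_on UNIV (\<lambda>q. D q h)" for h
      unfolding D_def E_def using R unfolding R_def
      by (intro continuous_on_vector_3 continuous_intros) (auto simp: less_imp_neq[symmetric])
    moreover have "\<phi> q \<in> smooth_part k" for q
    proof -
      define a b s where "a = fst q" and "b = snd q" and "s = sqrt (R a b)"
      have s: "s\<^sup>2 = (a * b)\<^sup>2 + 4 * (a\<^sup>2 + b\<^sup>2 + c)" "s > 0"
        using R[of a b] unfolding s_def R_def by auto
      have "((- (a * b) + s) / 2)\<^sup>2 + a * b * ((- (a * b) + s) / 2) = (s\<^sup>2 - (a * b)\<^sup>2) / 4"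
        by (simp add: field_simps power2_eq_square)
      then have "\<phi> q \<in> level k" unfolding level_iff \<phi>_def a_def[symmetric] b_def[symmetric] s_def[symmetric]
        using s(1) by (simp add: c_def)
      moreover have "\<phi> q \<noteq> 0"
      proof
        assume "\<phi> q = 0"
        then have "\<phi> q $ 1 = 0" "\<phi> q $ 2 = 0" "\<phi> q $ 3 = 0" by simp_all
        then show False using s(2) unfolding \<phi>_def a_def b_def s_def by simp
      qed
      ultimately show ?thesis by (simp add: smooth_part_eq)
    qed
    ultimately have chart: "chart_of_level k UNIV \<phi> D" unfolding chart_of_level_def by auto
    define g where "g = (\<lambda>p :: real^3. vector [p$1, - p$2, - p$3] :: real^3)"
    have "g \<in> Gamma_generators" by (simp add: Gamma_generators_def g_def)
    then obtain D' where chart': "chart_of_level k UNIV (g \<circ> \<phi>) D'" using chart_generator[OF chart] by blast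
    have z: "{(0, 0)} \<in> null_sets (lborel :: (real \<times> real) measure)" by (simp add: null_sets_def)
    have "\<phi> ` {(0, 0)} \<in> null_sets M" "(g \<circ> \<phi>) ` {(0, 0)} \<in> null_sets M"
      using chart_null[OF M chart z] chart_null[OF M chart' z] by auto
    then have "\<phi> ` {(0, 0)} \<union> (g \<circ> \<phi>) ` {(0, 0)} \<in> null_sets M" by (rule null_sets.Un)
    moreover have "{p \<in> level k. p$1 = 0 \<and> p$2 = 0} = \<phi> ` {(0, 0)} \<union> (g \<circ> \<phi>) ` {(0, 0)}"
    proof -
      have "\<phi> (0, 0) = vector [0, 0, sqrt c]" unfolding \<phi>_def R_def by (simp add: real_sqrt_mult)
      then have pts: "\<phi> ` {(0, 0)} \<union> (g \<circ> \<phi>) ` {(0, 0)} = {vector [0, 0, sqrt c], vector [0, 0, - sqrt c]}"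
        by (simp add: g_def insert_commute)
      have v: "p = vector [0, 0, s] \<longleftrightarrow> p$1 = 0 \<and> p$2 = 0 \<and> p$3 = s" for p :: "real^3" and s
        by (simp add: vec_eq_iff forall_3)
      have sq: "x\<^sup>2 = c \<longleftrightarrow> x = sqrt c \<or> x = - sqrt c" for x
        using power2_eq_iff[of x "sqrt c"] 3 by simp
      show ?thesis unfolding axis pts sq set_eq_iff insert_iff v by blast
    qed
    ultimately show ?thesis by simp
  qed
qed

section \<open>Ergodicity\<close>

text \<open>Parameters that have to be removed so that the descent applies to the remaining points: the boundary
  height \<open>\<bar>z\<bar> = 2\<close>, the coordinate planes, which are \<open>z + w = 0\<close> since \<open>x * y = - (z + w)\<close>, and the points
  sent by the first or second Vieta involution to the diagonals \<open>\<bar>x\<bar> = \<bar>y\<bar>\<close>. The diagonals themselves are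
  outside the image of the parametrization; they are treated through these neighbours.\<close>

definition exceptional :: "real \<Rightarrow> (real \<times> real) set" where
  "exceptional c = {q \<in> param_dom c. \<bar>fst q\<bar> = 2 \<or> fst q + snd q = 0 \<or>
    (param c q $ 2 * fst q - param c q $ 1)\<^sup>2 = (param c q $ 2)\<^sup>2 \<or>
    (param c q $ 1 * fst q - param c q $ 2)\<^sup>2 = (param c q $ 1)\<^sup>2}"

text \<open>At a height with \<open>\<bar>z\<bar> \<noteq> 2\<close> only finitely many parameters are exceptional: the condition makes \<open>x\<close>
  proportional to \<open>y\<close>, the level equation then fixes \<open>y\<^sup>2\<close>, and \<open>y\<^sup>2\<close> fixes \<open>w\<close>.\<close>

lemma exceptional_vieta:
  fixes x y z w c :: real
  assumes z: "\<bar>z\<bar> \<noteq> 2" and lev: "x\<^sup>2 + y\<^sup>2 - x * y * z = z\<^sup>2 - c" and w: "w = - x * y - z"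
    and e: "(y * z - x)\<^sup>2 = y\<^sup>2"
  shows "w = - (z + 1) * (z\<^sup>2 - c) / (z + 2) - z \<or> w = - (z - 1) * (z\<^sup>2 - c) / (2 - z) - z"
proof -
  have z2: "z + 2 \<noteq> 0" "2 - z \<noteq> 0" using z by auto
  have "y * z - x = - y \<or> y * z - x = y" using e by (auto simp: power2_eq_iff)
  then show ?thesis
  proof
    assume "y * z - x = - y"
    then have x: "x = (z + 1) * y" by (simp add: algebra_simps)
    have "y\<^sup>2 * (z + 2) = z\<^sup>2 - c" using lev unfolding x by (simp add: algebra_simps power2_eq_square)
    then have "y\<^sup>2 = (z\<^sup>2 - c) / (z + 2)" using z2 by (simp add: field_simps)
    moreover have "w = - (z + 1) * y\<^sup>2 - z" unfolding w x by (simp add: power2_eq_square algebra_simps)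
    ultimately show ?thesis by simp
  next
    assume "y * z - x = y"
    then have x: "x = (z - 1) * y" by (simp add: algebra_simps)
    have "y\<^sup>2 * (2 - z) = z\<^sup>2 - c" using lev unfolding x by (simp add: algebra_simps power2_eq_square)
    then have "y\<^sup>2 = (z\<^sup>2 - c) / (2 - z)" using z2 by (simp add: field_simps)
    moreover have "w = - (z - 1) * y\<^sup>2 - z" unfolding w x by (simp add: power2_eq_square algebra_simps)
    ultimately show ?thesis by simp
  qed
qed

lemma exceptional_null: "exceptional c \<in> null_sets lborel"
proof -
  have ci: "continuous_on UNIV (\<lambda>q. param c q $ i)" for i
    by (intro continuous_intros continuous_on_param)
  have "closed {q. \<bar>fst q\<bar> = 2 \<or> fst q + snd q = 0 \<or>
    (param c q $ 2 * fst q - param c q $ 1)\<^sup>2 = (param c q $ 2)\<^sup>2 \<or>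
    (param c q $ 1 * fst q - param c q $ 2)\<^sup>2 = (param c q $ 1)\<^sup>2}"
    by (intro closed_Collect_disj closed_Collect_eq continuous_intros ci)
  then have b: "exceptional c \<in> sets borel"
    unfolding exceptional_def Collect_conj_eq using open_param_dom[of c]
    by (intro sets.Int) auto
  have "AE z in lborel. Pair z -` exceptional c \<in> null_sets lborel"
    using AE_lborel_singleton[of 2] AE_lborel_singleton[of "- 2"]
  proof eventually_elim
    case (elim z)
    then have z: "\<bar>z\<bar> \<noteq> 2" by auto
    have "Pair z -` exceptional c \<subseteq> {- z, - (z + 1) * (z\<^sup>2 - c) / (z + 2) - z, - (z - 1) * (z\<^sup>2 - c) / (2 - z) - z}"
    proof
      fix w assume "w \<in> Pair z -` exceptional c"
      then have w: "(z, w) \<in> exceptional c" by simp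
      define x y where "x = param c (z, w) $ 1" and "y = param c (z, w) $ 2"
      have d: "(z, w) \<in> param_dom c" using w by (simp add: exceptional_def)
      have lev: "x\<^sup>2 + y\<^sup>2 - x * y * z = z\<^sup>2 - c" "w = - x * y - z"
        using param_level[OF d] param_vieta[OF d] unfolding x_def y_def by (simp_all del: param_nth)
      then have lev': "y\<^sup>2 + x\<^sup>2 - y * x * z = z\<^sup>2 - c" "w = - y * x - z" by (simp_all add: algebra_simps)
      have "z + w = 0 \<or> (y * z - x)\<^sup>2 = y\<^sup>2 \<or> (x * z - y)\<^sup>2 = x\<^sup>2"
        using w z unfolding exceptional_def x_def y_def by (simp del: param_nth)
      then consider "w = - z" | "(y * z - x)\<^sup>2 = y\<^sup>2" | "(x * z - y)\<^sup>2 = x\<^sup>2" by argo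
      then show "w \<in> {- z, - (z + 1) * (z\<^sup>2 - c) / (z + 2) - z, - (z - 1) * (z\<^sup>2 - c) / (2 - z) - z}"
        by cases (use exceptional_vieta[OF z lev] exceptional_vieta[OF z lev'] in auto)
    qed
    then have "finite (Pair z -` exceptional c)" by (rule finite_subset) simp
    then show ?case by (rule finite_imp_null_set_lborel)
  qed
  then show ?thesis using null_sets_prod_iff[OF b] by blast
qed

lemma words_axis:
  assumes "h \<in> words"
  shows "h p $ 1 = 0 \<and> h p $ 2 = 0 \<longleftrightarrow> p $ 1 = 0 \<and> p $ 2 = 0"
proof -
  have "g p \<in> {p. p $ 1 = 0 \<and> p $ 2 = 0} \<longleftrightarrow> p \<in> {p. p $ 1 = 0 \<and> p $ 2 = 0}" if "g \<in> Gamma_generators" for g p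
    using that unfolding Gamma_generators_def by auto
  then show ?thesis using words_invariant[of "{p. p $ 1 = 0 \<and> p $ 2 = 0}" h p] assms by simp
qed

text \<open>Off a null set, every orbit meets the elliptic region inside the image of the parametrization. Hence \<open>A\<close> is
  covered by countably many translates of its elliptic part and of the exceptional set,
  together with the axis \<open>x = y = 0\<close>.\<close>

lemma null_if_null_on_elliptic_region:
  assumes M: "is_area_measure k M" and k: "- 14 \<le> k" "k < 2" and A: "A \<in> sets M"
    and inv: "\<And>g p. g \<in> Gamma_generators \<Longrightarrow> g p \<in> A \<longleftrightarrow> p \<in> A"
    and null: "{q \<in> param_dom (k + 2). \<bar>fst q\<bar> < 2 \<and> param (k + 2) q \<in> A} \<in> null_sets lborel"
  shows "A \<in> null_sets M"
proof -
  define c where "c = k + 2"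
  define N where "N = {q \<in> param_dom c. \<bar>fst q\<bar> < 2 \<and> param c q \<in> A} \<union> exceptional c"
  have N: "N \<in> null_sets lborel" unfolding N_def c_def using null exceptional_null by (rule null_sets.Un)
  have N_sub: "N \<subseteq> param_dom c" by (auto simp: N_def exceptional_def)
  have "A \<subseteq> {p \<in> level k. p$1 = 0 \<and> p$2 = 0} \<union> (\<Union>h\<in>words. h ` param c ` N)"
  proof (rule subsetI, rule ccontr)
    fix p assume p: "p \<in> A" and not: "p \<notin> {p \<in> level k. p$1 = 0 \<and> p$2 = 0} \<union> (\<Union>h\<in>words. h ` param c ` N)"
    have pl: "p \<in> level k" using A p sets_area_measure[OF M] by auto
    define S where "S x y z \<longleftrightarrow> (\<exists>h\<in>words. h p = vector [x, y, z])" for x y z :: real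
    have S_step: "S x' y' z'" if "S x y z" "g \<in> Gamma_generators" "g (vector [x, y, z]) = vector [x', y', z']" for x y z x' y' z' g
      using that words_comp unfolding S_def by (metis comp_apply)
    have steps: "S x y z \<Longrightarrow> S (y * z - x) y z" "S x y z \<Longrightarrow> S x y (- x * y - z)"
      "S x y z \<Longrightarrow> S x (- y) (- z)" "S x y z \<Longrightarrow> S (- x) y (- z)"
      "S x y z \<Longrightarrow> S (- x) (- y) z" "S x y z \<Longrightarrow> S y x z" for x y z
      by (erule S_step, force simp: Gamma_generators_def, simp)+
    have S_level: "x\<^sup>2 + y\<^sup>2 - x * y * z = z\<^sup>2 - c" and S_A: "vector [x, y, z] \<in> A"
      and S_axis: "x \<noteq> 0 \<or> y \<noteq> 0" if "S x y z" for x y z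
    proof -
      obtain h where h: "h \<in> words" "h p = vector [x, y, z]" using \<open>S x y z\<close> unfolding S_def by blast
      show "x\<^sup>2 + y\<^sup>2 - x * y * z = z\<^sup>2 - c"
        using words_level[OF h(1), of p k] pl h(2) by (simp add: level_iff c_def)
      show "vector [x, y, z] \<in> A" using words_invariant[of A h p] inv h p by simp
      show "x \<noteq> 0 \<or> y \<noteq> 0" using words_axis[OF h(1), of p] not pl h(2) by auto
    qed
    have S_N: "(z, - x * y - z) \<notin> N" if "S x y z" "\<bar>y\<bar> < x" for x y z
    proof
      assume N: "(z, - x * y - z) \<in> N"
      obtain h where h: "h \<in> words" "h p = vector [x, y, z]" using \<open>S x y z\<close> unfolding S_def by blast
      obtain h' where h': "h' \<in> words" "\<And>p. h' (h p) = p" using words_inverse[OF h(1)] by blast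
      have "vector [x, y, z] \<in> level k" using words_level[OF h(1), of p k] pl h(2) by simp
      from param_onto(2)[OF this] have "param c (z, - x * y - z) = h p" using that h(2) by (simp add: c_def)
      then have "p = h' (param c (z, - x * y - z))" using h'(2)[of p] by simp
      then have "p \<in> h' ` param c ` N" using N by blast
      then show False using not h'(1) by blast
    qed
    \<comment> \<open>Sign changes and the transposition bring any point off the diagonals into the quarter \<open>\<bar>y\<bar> < x\<close>.\<close>
    have quadrant: "x * y \<noteq> 0 \<and> \<bar>z\<bar> > 2 \<and> (y * z - x)\<^sup>2 \<noteq> y\<^sup>2"
      if xyz: "S x y z" and ne: "\<bar>x\<bar> \<noteq> \<bar>y\<bar>" for x y z
    proof -
      have main: "x * y \<noteq> 0 \<and> \<bar>z\<bar> > 2 \<and> (y * z - x)\<^sup>2 \<noteq> y\<^sup>2 \<and> (x * z - y)\<^sup>2 \<noteq> x\<^sup>2"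
        if xyz: "S x y z" and lt: "\<bar>y\<bar> < x" for x y z
      proof -
        have l: "vector [x, y, z] \<in> level k" using S_level[OF xyz] by (simp add: level_iff c_def)
        have d: "(z, - x * y - z) \<in> param_dom c" "param c (z, - x * y - z) = vector [x, y, z]"
          using param_onto[OF l] lt by (simp_all add: c_def)
        have n: "param c (z, - x * y - z) $ 1 = x" "param c (z, - x * y - z) $ 2 = y" using d(2) by simp_all
        show ?thesis
          using S_N[OF xyz lt] S_A[OF xyz] d unfolding N_def exceptional_def
          by (auto simp: n simp del: param_nth)
      qed
      consider "\<bar>y\<bar> < x" | "\<bar>y\<bar> < - x" | "\<bar>x\<bar> < y" | "\<bar>x\<bar> < - y" using ne by linarith
      then show ?thesis
      proof cases
        case 1 then show ?thesis using main[OF xyz] by blast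
      next
        case 2 then show ?thesis using main[OF steps(5)[OF xyz]] by (simp add: power2_commute)
      next
        case 3 then show ?thesis using main[OF steps(6)[OF xyz]] by (simp add: mult.commute)
      next
        case 4 then show ?thesis using main[OF steps(5)[OF steps(6)[OF xyz]]] by (simp add: power2_commute mult.commute)
      qed
    qed
    have off_diagonal: "\<bar>x\<bar> \<noteq> \<bar>y\<bar>" if xyz: "S x y z" for x y z
    proof -
      \<comment> \<open>The first Vieta involution moves a diagonal point with \<open>z \<noteq> 0\<close> off the diagonals, to an exceptional point.\<close>
      have nz: "\<bar>x\<bar> \<noteq> \<bar>y\<bar>" if xyz: "S x y z" and "z \<noteq> 0" for x y z
      proof
        assume e: "\<bar>x\<bar> = \<bar>y\<bar>"
        then have y0: "y \<noteq> 0" using S_axis[OF xyz] by auto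
        have c4: "c < 4" using k by (simp add: c_def)
        \<comment> \<open>Otherwise \<open>y * z = 2 * x\<close> and \<open>z\<^sup>2 = 4\<close>, and the level equation reads \<open>c = 4\<close>.\<close>
        have "\<bar>y * z - x\<bar> \<noteq> \<bar>y\<bar>"
        proof
          assume "\<bar>y * z - x\<bar> = \<bar>y\<bar>"
          then have sq: "(y * z - x)\<^sup>2 = y\<^sup>2" and xy: "x\<^sup>2 = y\<^sup>2" using e by (metis power2_abs)+
          then have "(y * z) * (y * z - 2 * x) = 0" by (simp add: algebra_simps power2_eq_square)
          then have yz: "y * z = 2 * x" using y0 \<open>z \<noteq> 0\<close> by simp
          then have "(y * z)\<^sup>2 = 4 * x\<^sup>2" by (simp add: power2_eq_square)
          then have "y\<^sup>2 * z\<^sup>2 = 4 * y\<^sup>2" by (simp add: power_mult_distrib xy)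
          then have "z\<^sup>2 = 4" using y0 by simp
          moreover have "x * y * z = 2 * x\<^sup>2" using yz by (simp add: mult.assoc power2_eq_square)
          ultimately show False using S_level[OF xyz] xy c4 by simp
        qed
        from quadrant[OF steps(1)[OF xyz] this]
        have "(y * z - (y * z - x))\<^sup>2 \<noteq> y\<^sup>2" by blast
        then have "x\<^sup>2 \<noteq> y\<^sup>2" by simp
        then show False using e by (metis power2_abs)
      qed
      show ?thesis
      proof (cases "z = 0")
        case True
        show ?thesis
        proof
          assume e: "\<bar>x\<bar> = \<bar>y\<bar>"
          \<comment> \<open>At height 0 the third Vieta involution first produces a diagonal point of nonzero height.\<close>
          then have "- x * y - z \<noteq> 0" using S_axis[OF xyz] True by auto
          then show False using nz[OF steps(2)[OF xyz]] e by blast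
        qed
      qed (use nz[OF xyz] in blast)
    qed
    interpret closed_orbit S c
    proof
      show "x \<noteq> 0 \<and> y \<noteq> 0" if "S x y z" for x y z using quadrant[OF that off_diagonal[OF that]] by simp
    qed (use steps S_level k in \<open>auto simp: c_def\<close>)
    have "S (p$1) (p$2) (p$3)" unfolding S_def
      by (rule bexI[OF _ words_id]) (simp add: vec_eq_iff forall_3)
    from reach_elliptic[OF _ this] obtain x y z where "S x y z" "\<bar>z\<bar> \<le> 2" using k by (auto simp: c_def)
    then show False using quadrant[OF _ off_diagonal] by fastforce
  qed
  moreover have "(\<Union>h\<in>words. h ` param c ` N) \<in> null_sets M"
    using words_param_null[OF M N] N_sub countable_words by (intro null_sets_UN') (auto simp: c_def)
  ultimately show ?thesis
    using null_sets_subset[OF null_sets.Un[OF axis_null[OF M]] A] by blast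
qed

theorem mainTheorem2:
  fixes k :: real and M :: "(real^3) measure"
  assumes "- 14 \<le> k" and "k < 2"
    and "is_area_measure k M"
  shows "ergodic_action Gamma_group M"
  unfolding ergodic_action_def
proof (intro ballI impI)
  fix A assume A: "A \<in> sets M" and G: "\<forall>g\<in>Gamma_group. g ` A = A"
  note M = assms(3)
  define c where "c = k + 2"
  have inv: "g p \<in> A \<longleftrightarrow> p \<in> A" if "g \<in> Gamma_generators" for g p
  proof -
    have "g ` A = A" using G generators_in_Gamma_group[OF that] by blast
    then show ?thesis using Gamma_generators_involutive[OF that, of p] by (metis imageI)
  qed
  have Ab: "A \<in> sets borel" using A sets_area_measure[OF M] by auto
  define T where "T = {q \<in> param_dom c. param c q \<in> A}"
  have "param c \<in> borel_measurable borel" by (intro borel_measurable_continuous_onI continuous_on_param)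
  from measurable_sets_borel[OF this Ab] have T: "T \<in> sets borel"
    unfolding T_def Collect_conj_eq using open_param_dom[of c] by (intro sets.Int) (auto simp: vimage_def)
  have gen: "(\<lambda>p. vector [p$1, p$2, - p$1 * p$2 - p$3]) \<in> Gamma_generators"
    "(\<lambda>p. vector [p$1, - p$2, - p$3]) \<in> Gamma_generators"
    "(\<lambda>p. vector [p$2 * p$3 - p$1, p$2, p$3]) \<in> Gamma_generators"
    "(\<lambda>p. vector [p$2, p$1, p$3]) \<in> Gamma_generators"
    unfolding Gamma_generators_def by blast+
  have swap: "(z, w) \<in> T \<longleftrightarrow> (w, z) \<in> T" for z w
  proof (cases "(z, w) \<in> param_dom c")
    case True
    have "param c (w, z) = vector [param c (z, w) $ 1, param c (z, w) $ 2, - param c (z, w) $ 1 * param c (z, w) $ 2 - param c (z, w) $ 3]"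
      using param_vieta[OF True] by (simp add: vec_eq_iff forall_3 sq_sum_commute[of c w z] sq_diff_commute[of c w z])
    then show ?thesis using inv[OF gen(1), of "param c (z, w)"] param_dom_swap[of w z c] by (simp add: T_def)
  qed (use param_dom_swap[of w z c] in \<open>simp add: T_def\<close>)
  have minus: "(z, w) \<in> T \<longleftrightarrow> (- z, - w) \<in> T" for z w
  proof -
    have "param c (- z, - w) = vector [param c (z, w) $ 1, - param c (z, w) $ 2, - param c (z, w) $ 3]"
      by (simp add: vec_eq_iff forall_3 sq_sum_minus sq_diff_minus field_simps)
    then show ?thesis using inv[OF gen(2), of "param c (z, w)"] param_dom_minus[of z w c] by (simp add: T_def)
  qed
  have "AE z in lborel. z \<notin> {z. \<bar>z\<bar> < 2 \<and> arccos (z / 2) / (2 * pi) \<in> \<rat>}"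
    by (intro AE_not_in countable_imp_null_set_lborel countable_rational_rotation)
  then have "AE z in lborel. \<bar>z\<bar> < 2 \<longrightarrow> negligible (Pair z -` T) \<or> negligible (Pair z -` (param_dom c - T))"
  proof eventually_elim
    case (elim z)
    have "vector [p$2, p$2 * p$3 - p$1, p$3] \<in> A \<longleftrightarrow> p \<in> A" for p
      using inv[OF gen(4), of "vector [p$2 * p$3 - p$1, p$2, p$3]"] inv[OF gen(3), of p] by simp
    moreover have "Pair z -` T = {w. (z, w) \<in> param_dom c \<and> param c (z, w) \<in> A}"
      "Pair z -` (param_dom c - T) = {w. (z, w) \<in> param_dom c \<and> param c (z, w) \<notin> A}"
      by (auto simp: T_def)
    ultimately show ?case using rotation_slices[OF Ab, of z c] elim by auto
  qed
  from zero_one_elliptic_region[OF _ T _ swap minus this]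
  consider "T \<inter> {q. \<bar>fst q\<bar> < 2} \<in> null_sets lborel" | "(param_dom c - T) \<inter> {q. \<bar>fst q\<bar> < 2} \<in> null_sets lborel"
    using assms by (auto simp: T_def c_def)
  then show "A \<in> null_sets M \<or> space M - A \<in> null_sets M"
  proof cases
    case 1
    moreover have "T \<inter> {q. \<bar>fst q\<bar> < 2} = {q \<in> param_dom (k + 2). \<bar>fst q\<bar> < 2 \<and> param (k + 2) q \<in> A}"
      by (auto simp: T_def c_def)
    ultimately have "A \<in> null_sets M"
      by (intro null_if_null_on_elliptic_region[OF M assms(1,2) A]) (simp_all add: inv)
    then show ?thesis ..
  next
    case 2
    have sp: "space M = level k" by (rule space_area_measure[OF M])
    have inv': "g p \<in> space M - A \<longleftrightarrow> p \<in> space M - A" if "g \<in> Gamma_generators" for g p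
      using inv[OF that] Gamma_generators_preserve_kappa[OF that] by (simp add: sp level_def)
    have "(param_dom c - T) \<inter> {q. \<bar>fst q\<bar> < 2} = {q \<in> param_dom (k + 2). \<bar>fst q\<bar> < 2 \<and> param (k + 2) q \<in> space M - A}"
      using param_in_level[of _ k] by (auto simp: T_def c_def sp)
    then have "space M - A \<in> null_sets M"
      using A 2 by (intro null_if_null_on_elliptic_region[OF M assms(1,2)]) (simp_all add: inv' del: Diff_iff)
    then show ?thesis ..
  qed
qed

end
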